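(* There exists an absolute constant $C>0$ such that for all $h,s>0$ and all $n\ge 3$, $$\sup_{\pi\in\mathcal P([0,h])}\mathsf{Regret}_\pi(\hat f_{\mathsf{erm}})\le \frac{C\max\{1,h\}^3}{n}\Big(\frac{\log n}{\log\log n}\Big)^2,\qquad \sup_{\pi\in\mathsf{SubE}(s)}\mathsf{Regret}_\pi(\hat f_{\mathsf{erm}})\le \frac{C\max\{1,s\}^3}{n}(\log n)^3,$$ where $\hat f_{\mathsf{erm}}$ is the ERM estimator over the class of all nondecreasing functions, computed from a training sample of size $n$.
   Context: For a probability distribution $\pi$ on $[0,\infty)$, the Poisson mixture is $p_\pi(x)=\int e^{-\theta}\theta^x/x!\,d\pi(\theta)$, $x\in\mathbb Z_+=\{0,1,2,\dots\}$. The Bayes estimator is $f^*(x)=(x+1)p_\pi(x+1)/p_\pi(x)=\mathbb E[\theta\mid X=x]$. The training sample $X_1,\dots,X_n$ is i.i.d. from $p_\pi$. ERM estimator: let $\mathcal F$ be the class of nondecreasing functions $f:\mathbb Z_+\to[0,\infty)$, with the convention $f(-1)=0$. Then $\hat f_{\mathsf{erm}}$ is a minimizer over $\mathcal F$ of $\hat R(f)=\frac1n\sum_{i=1}^n\big[f(X_i)^2-2X_if(X_i-1)\big]$. Its values are uniquely determined on $S=(\{X_1,\dots,X_n\}\cup\{X_1-1,\dots,X_n-1\})\cap\mathbb Z_+$. It is extended to all of $\mathbb Z_+$ by setting $\hat f_{\mathsf{erm}}(x)=0$ for $x<\min S$ and $\hat f_{\mathsf{erm}}(x)=\hat f_{\mathsf{erm}}(\max\{y\in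 S:y\le x\})$ otherwise. Regret: $\mathsf{Regret}_\pi(\hat f)=\mathbb E[(\hat f(X)-\theta)^2]-\mathbb E[(f^*(X)-\theta)^2]$. Here $\theta\sim\pi$ and, given $\theta$, $X\sim\mathrm{Poi}(\theta)$. The pair $(\theta,X)$ is independent of the training sample, and the expectation is taken over both the test pair and the training sample. $\mathcal P([0,h])$ denotes the set of all probability distributions supported on $[0,h]$. $\mathsf{SubE}(s)=\{G \text{ distribution on }\mathbb R_+: G([t,\infty))\le 2e^{-t/s}\ \forall t>0\}$. *)

theory Defs
  imports "HOL-Probability.Probability"
begin

definition poi :: "real \<Rightarrow> nat \<Rightarrow> real" where
  "poi \<theta> x = exp (- \<theta>) * \<theta> ^ x / fact x"

definition pmix :: "real measure \<Rightarrow> nat \<Rightarrow> real" where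
  "pmix \<pi> x = (\<integral>\<theta>. poi \<theta> x \<partial>\<pi>)"

definition bayes_est :: "real measure \<Rightarrow> nat \<Rightarrow> real" where
  "bayes_est \<pi> x = real (x + 1) * pmix \<pi> (x + 1) / pmix \<pi> x"

definition monoF :: "(nat \<Rightarrow> real) set" where
  "monoF = {f. mono f \<and> (\<forall>x. 0 \<le> f x)}"

text \<open>Empirical risk, with the convention f(-1) = 0\<close>
definition emp_risk :: "nat list \<Rightarrow> (nat \<Rightarrow> real) \<Rightarrow> real" where
  "emp_risk xs f = (1 / real (length xs)) *
     sum_list (map (\<lambda>x. (f x)\<^sup>2 - 2 * real x * (if x = 0 then 0 else f (x - 1))) xs)"

definition erm_min :: "nat list \<Rightarrow> nat \<Rightarrow> real" where
  "erm_min xs = (SOME g. g \<in> monoF \<and> (\<forall>f\<in>monoF. emp_risk xs g \<le> emp_risk xs f))"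

definition erm_S :: "nat list \<Rightarrow> nat set" where
  "erm_S xs = set xs \<union> {x - 1 | x. x \<in> set xs \<and> 1 \<le> x}"

definition erm :: "nat list \<Rightarrow> nat \<Rightarrow> real" where
  "erm xs x = (if x < Min (erm_S xs) then 0
               else erm_min xs (Max {y \<in> erm_S xs. y \<le> x}))"

text \<open>Test risk E[(f(X) - theta)^2], theta ~ pi, X | theta ~ Poi(theta)\<close>
definition test_risk :: "real measure \<Rightarrow> (nat \<Rightarrow> real) \<Rightarrow> ennreal" where
  "test_risk \<pi> f = (\<integral>\<^sup>+\<theta>. (\<Sum>x. ennreal (poi \<theta> x * (f x - \<theta>)\<^sup>2)) \<partial>\<pi>)"

text \<open>Risk of the ERM estimator, averaged over an iid training sample of size n from p_pi\<close>
definition erm_risk :: "real measure \<Rightarrow> nat \<Rightarrow> ennreal" where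
  "erm_risk \<pi> n = (\<integral>\<^sup>+xs. ennreal (prod_list (map (pmix \<pi>) xs)) * test_risk \<pi> (erm xs)
                     \<partial>count_space {xs. length xs = n})"

text \<open>Regret bound: Regret_pi(erm) <= B, written as risk(erm) <= risk(f*) + B\<close>
definition regret_le :: "real measure \<Rightarrow> nat \<Rightarrow> real \<Rightarrow> bool" where
  "regret_le \<pi> n B \<longleftrightarrow> erm_risk \<pi> n \<le> test_risk \<pi> (bayes_est \<pi>) + ennreal B"

definition supported_on_0h :: "real \<Rightarrow> real measure \<Rightarrow> bool" where
  "supported_on_0h h \<pi> \<longleftrightarrow> prob_space \<pi> \<and> sets \<pi> = sets borel \<and> measure \<pi> {0..h} = 1"

definition SubE :: "real \<Rightarrow> real measure \<Rightarrow> bool" where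
  "SubE s \<pi> \<longleftrightarrow> prob_space \<pi> \<and> sets \<pi> = sets borel \<and> measure \<pi> {0..} = 1 \<and>
     (\<forall>t>0. measure \<pi> {t..} \<le> 2 * exp (- t / s))"

end

theory Submission
  imports Defs
begin

text \<open>Write \<open>p\<close> for the mixture density, \<open>f*\<close> for the Bayes estimator, \<open>N x\<close> for the number of
  observations equal to \<open>x\<close>, and compare the ERM with the truncation \<open>g = min f* T\<close>, which is
  again monotone since \<open>f*\<close> is. Optimality in the convex class gives, for \<open>\<Delta> = erm - g\<close>,
  \<open>\<Sum>x. N x * (\<Delta> x)\<^sup>2 \<le> \<Sum>x. \<Delta> x * Z x\<close> with \<open>Z x = (x + 1) * N (x + 1) - g x * N x\<close>, whose mean
  \<open>n * p x * (f* x - g x)\<close> vanishes except where \<open>f*\<close> exceeds \<open>T\<close>. Replacing \<open>N x\<close> by \<open>n * p x\<close>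
  costs \<open>(n * p x - 2 * N x)\<^sub>+ * (\<Delta> x)\<^sup>2\<close>, and by the inequality between arithmetic and geometric mean
  the problem splits over the points \<open>x\<close>: each of them contributes about
  \<open>((x + 1) * f* x + (f* x)\<^sup>2) / n\<close> from the variance of \<open>Z x\<close>, and the undercounts contribute
  \<open>m\<^sup>2 / n\<close> times the number of points where \<open>n * p x\<close> is of order one, where \<open>m\<close> bounds all
  observations with overwhelming probability. For bounded support \<open>p\<close> decays geometrically beyond
  \<open>2 * h\<close>, so that only \<open>O(max 1 h)\<close> points matter for the undercount; in the subexponential case
  all \<open>m\<close> points are counted.\<close>

subsection \<open>Empirical risk minimisation over monotone functions\<close>

text \<open>The unnormalised empirical risk. At \<open>x = 0\<close> the truncated subtraction reads
  \<open>f 0\<close> where the convention prescribes 0, but the factor \<open>real x\<close>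
  vanishes there, so the case distinction disappears.\<close>

definition emp_loss :: "nat list \<Rightarrow> (nat \<Rightarrow> real) \<Rightarrow> real" where
  "emp_loss xs f = (\<Sum>x\<leftarrow>xs. (f x)\<^sup>2 - 2 * real x * f (x - 1))"

lemma emp_risk_eq: "emp_risk xs f = emp_loss xs f / real (length xs)"
proof -
  have "map (\<lambda>x. (f x)\<^sup>2 - 2 * real x * (if x = 0 then 0 else f (x - 1))) xs
      = map (\<lambda>x. (f x)\<^sup>2 - 2 * real x * f (x - 1)) xs"
    by (rule map_cong) auto
  then show ?thesis
    unfolding emp_risk_def emp_loss_def by (simp only: mult.commute divide_inverse mult_1)
qed

lemma emp_risk_le_iff:
  assumes "xs \<noteq> []"
  shows "emp_risk xs f \<le> emp_risk xs g \<longleftrightarrow> emp_loss xs f \<le> emp_loss xs g"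
  using assms by (simp add: emp_risk_eq divide_le_cancel)

lemma monoF_D:
  assumes "f \<in> monoF"
  shows "0 \<le> f x" "x \<le> y \<Longrightarrow> f x \<le> f y"
  using assms by (auto simp: monoF_def dest: monoD)

lemma monoF_I:
  assumes "\<And>x. 0 \<le> f x" "\<And>x y. x \<le> y \<Longrightarrow> f x \<le> f y"
  shows "f \<in> monoF"
  using assms by (simp add: monoF_def mono_def)

lemma monoF_min:
  assumes "f \<in> monoF" "0 \<le> c"
  shows "(\<lambda>x. min (f x) c) \<in> monoF"
  using monoF_D[OF assms(1)] assms(2)
  by (intro monoF_I) (simp_all add: min_def, meson order_trans linear)

text \<open>Let \<open>d\<close> be the excess of \<open>f\<close> over \<open>c\<close>. Clipping
  lowers the squares by \<open>2 * c * d x + (d x)^2\<close> and raises the linear part by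
  \<open>2 * x * d (x - 1)\<close>, which is at most \<open>2 * c * d x\<close> because
  \<open>x\<close> is at most \<open>c\<close> and \<open>d\<close> is monotone. The surplus squares
  are kept on the left: they later force a minimiser to have no excess.\<close>

lemma emp_loss_min:
  assumes f: "f \<in> monoF" and c: "\<And>x. x \<in> set xs \<Longrightarrow> real x \<le> c"
  shows "emp_loss xs (\<lambda>x. min (f x) c) + (\<Sum>x\<leftarrow>xs. (max 0 (f x - c))\<^sup>2) \<le> emp_loss xs f"
proof -
  have pt: "((min (f x) c)\<^sup>2 - 2 * real x * min (f (x - 1)) c) + (max 0 (f x - c))\<^sup>2
      \<le> (f x)\<^sup>2 - 2 * real x * f (x - 1)" if "x \<in> set xs" for x
  proof -
    define d where "d = (\<lambda>y. max 0 (f y - c))"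
    have m: "min (f y) c = f y - d y" for y
      unfolding d_def by (auto simp: min_def max_def)
    have le: "d (x - 1) \<le> d x" "0 \<le> d (x - 1)"
      using monoF_D(2)[OF f, of "x - 1" x] unfolding d_def by auto
    have dc: "d x * (f x - d x) = c * d x"
      unfolding d_def by (auto simp: max_def)
    have "real x * d (x - 1) \<le> c * d x"
      using le c[OF that] by (intro mult_mono) auto
    moreover have "(f x - d x)\<^sup>2 + (d x)\<^sup>2 = (f x)\<^sup>2 - 2 * (d x * (f x - d x))"
      by (simp add: power2_eq_square algebra_simps)
    ultimately show ?thesis
      using dc d_def unfolding m by (simp add: algebra_simps)
  qed
  show ?thesis
    unfolding emp_loss_def sum_list_addf[symmetric] by (intro sum_list_mono pt)
qed

lemma emp_loss_min_le:
  assumes "f \<in> monoF" and "\<And>x. x \<in> set xs \<Longrightarrow> real x \<le> c"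
  shows "emp_loss xs (\<lambda>x. min (f x) c) \<le> emp_loss xs f"
proof -
  have "0 \<le> (\<Sum>x\<leftarrow>xs. (max 0 (f x - c))\<^sup>2)" by (intro sum_list_nonneg) auto
  moreover have "emp_loss xs (\<lambda>x. min (f x) c) + (\<Sum>x\<leftarrow>xs. (max 0 (f x - c))\<^sup>2) \<le> emp_loss xs f"
    using assms by (intro emp_loss_min)
  ultimately show ?thesis by linarith
qed

text \<open>Tychonoff: the cube with sides \<open>{0..c}\<close> is compact in the product topology,
  and each monotonicity constraint is a closed condition on two coordinates.\<close>

lemma compact_bounded_monoF: "compact {f \<in> monoF. \<forall>x. f x \<le> c}"
proof -
  have "compactin (product_topology (\<lambda>_. euclidean) UNIV) (PiE UNIV (\<lambda>_::nat. {0..c}))"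
    unfolding compactin_PiE by simp
  then have *: "compact (PiE UNIV (\<lambda>_::nat. {0..c}))"
    by (simp add: euclidean_product_topology)
  have "closed {f :: nat \<Rightarrow> real. f x \<le> f y}" for x y
    by (intro closed_Collect_le continuous_on_product_coordinates)
  then have "closed (\<Inter>x. \<Inter>y\<in>{x..}. {f :: nat \<Rightarrow> real. f x \<le> f y})"
    by (intro closed_INT ballI)
  from compact_Int_closed[OF * this] show ?thesis
    by (rule back_subst[of compact]) (auto simp: monoF_def mono_def PiE_def)
qed

lemma continuous_on_emp_loss: "continuous_on A (emp_loss xs)"
proof (induction xs)
  case (Cons x xs)
  have [continuous_intros]: "continuous_on A (\<lambda>f :: nat \<Rightarrow> real. f y)" for y
    by (rule continuous_on_subset[OF continuous_on_product_coordinates]) auto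
  have "emp_loss (x # xs) = (\<lambda>f. (f x)\<^sup>2 - 2 * real x * f (x - 1) + emp_loss xs f)"
    by (auto simp: emp_loss_def)
  then show ?case by (auto intro!: continuous_intros Cons)
qed (simp add: emp_loss_def)

text \<open>Clipping at the largest observation never increases the loss, so the infimum may be
  sought in a compact set, where continuity attains it.\<close>

lemma emp_loss_minimizer_exists:
  "\<exists>g\<in>monoF. \<forall>f\<in>monoF. emp_loss xs g \<le> emp_loss xs f"
proof -
  \<comment> \<open>Inserting 0 keeps \<open>c\<close> meaningful for an empty sample.\<close>
  define c where "c = real (Max (insert 0 (set xs)))"
  have c: "\<And>x. x \<in> set xs \<Longrightarrow> real x \<le> c" and c0: "0 \<le> c"
    unfolding c_def by auto
  let ?K = "{f \<in> monoF. \<forall>x. f x \<le> c}"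
  have "(\<lambda>_. 0) \<in> ?K" using c0 by (auto simp: monoF_def mono_def)
  then have ne: "?K \<noteq> {}" by blast
  obtain g where g: "g \<in> ?K" "\<forall>f\<in>?K. emp_loss xs g \<le> emp_loss xs f"
    using continuous_attains_inf[OF compact_bounded_monoF ne continuous_on_emp_loss] by blast
  have "emp_loss xs g \<le> emp_loss xs f" if f: "f \<in> monoF" for f
  proof -
    have "(\<lambda>x. min (f x) c) \<in> ?K" using monoF_min[OF f c0] by auto
    then have "emp_loss xs g \<le> emp_loss xs (\<lambda>x. min (f x) c)" using g(2) by blast
    also have "\<dots> \<le> emp_loss xs f" using c by (intro emp_loss_min_le f)
    finally show ?thesis .
  qed
  with g(1) show ?thesis by blast
qed

text \<open>\<open>erm_min\<close> is a Hilbert choice, so existence must be known before anything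
  can be said about it. From here on only its membership in the class and its minimality are
  used.\<close>

lemma erm_min_properties:
  assumes "xs \<noteq> []"
  shows "erm_min xs \<in> monoF" "f \<in> monoF \<Longrightarrow> emp_loss xs (erm_min xs) \<le> emp_loss xs f"
proof -
  have "\<exists>g. g \<in> monoF \<and> (\<forall>f\<in>monoF. emp_risk xs g \<le> emp_risk xs f)"
    using emp_loss_minimizer_exists[of xs] emp_risk_le_iff[OF assms] by blast
  from someI_ex[OF this]
  have "erm_min xs \<in> monoF \<and> (\<forall>f\<in>monoF. emp_risk xs (erm_min xs) \<le> emp_risk xs f)"
    unfolding erm_min_def .
  then show "erm_min xs \<in> monoF" "f \<in> monoF \<Longrightarrow> emp_loss xs (erm_min xs) \<le> emp_loss xs f"
    using emp_risk_le_iff[OF assms] by auto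
qed

text \<open>Clipping at the sample maximum would gain the sum of squared excesses over the sample;
  minimality makes this sum zero. The bound is confined to observed points, since only these squares
  enter the loss.\<close>

lemma erm_min_le_Max:
  assumes "xs \<noteq> []" "x \<in> set xs"
  shows "erm_min xs x \<le> real (Max (set xs))"
proof -
  define c where "c = real (Max (set xs))"
  let ?g = "erm_min xs"
  note g = erm_min_properties[OF assms(1)]
  have c: "real x \<le> c" if "x \<in> set xs" for x
    using that by (simp add: c_def)
  have "(\<lambda>x. min (?g x) c) \<in> monoF" by (intro monoF_min g) (simp add: c_def)
  then have "emp_loss xs ?g \<le> emp_loss xs (\<lambda>x. min (?g x) c)" by (rule g)
  moreover have "emp_loss xs (\<lambda>x. min (?g x) c) + (\<Sum>x\<leftarrow>xs. (max 0 (?g x - c))\<^sup>2)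
      \<le> emp_loss xs ?g"
    using c by (intro emp_loss_min g(1))
  ultimately have le: "(\<Sum>x\<leftarrow>xs. (max 0 (?g x - c))\<^sup>2) \<le> 0" by linarith
  have "(max 0 (?g x - c))\<^sup>2 \<le> (\<Sum>x\<leftarrow>xs. (max 0 (?g x - c))\<^sup>2)"
    using assms(2) by (intro member_le_sum_list) auto
  with le have "max 0 (?g x - c) = 0" by (metis power2_less_eq_zero_iff order_trans)
  then show ?thesis unfolding c_def by linarith
qed

section \<open>Extension of the minimiser to all points as a step function\<close>

lemma erm_S_props:
  shows "finite (erm_S xs)" "set xs \<subseteq> erm_S xs"
    and "x \<in> set xs \<Longrightarrow> 1 \<le> x \<Longrightarrow> x - 1 \<in> erm_S xs"
    and "y \<in> erm_S xs \<Longrightarrow> \<exists>x\<in>set xs. y \<le> x"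
proof -
  have "erm_S xs = set xs \<union> (\<lambda>x. x - 1) ` {x \<in> set xs. 1 \<le> x}"
    unfolding erm_S_def by auto
  then show "finite (erm_S xs)" by simp
next
  show "\<exists>x\<in>set xs. y \<le> x" if "y \<in> erm_S xs"
    using that diff_le_self unfolding erm_S_def by blast
qed (auto simp: erm_S_def)

lemma erm_eq_erm_min:
  assumes "y \<in> erm_S xs"
  shows "erm xs y = erm_min xs y"
proof -
  have "Max {z \<in> erm_S xs. z \<le> y} = y"
    using assms erm_S_props(1)[of xs] by (intro Max_eqI) auto
  moreover have "Min (erm_S xs) \<le> y" using assms erm_S_props(1)[of xs] by simp
  ultimately show ?thesis unfolding erm_def by simp
qed

lemma erm_cases:
  assumes "xs \<noteq> []"
  obtains "x < Min (erm_S xs)" "erm xs x = 0"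
  | y where "y \<in> erm_S xs" "y \<le> x" "erm xs x = erm_min xs y"
proof (cases "x < Min (erm_S xs)")
  case False
  have ne: "erm_S xs \<noteq> {}" using assms erm_S_props(2)[of xs] by auto
  define y where "y = Max {z \<in> erm_S xs. z \<le> x}"
  have "y \<in> {z \<in> erm_S xs. z \<le> x}"
    unfolding y_def using False Min_in[OF erm_S_props(1) ne] erm_S_props(1)[of xs]
    by (intro Max_in) auto
  moreover have "erm xs x = erm_min xs y" using False by (simp add: erm_def y_def)
  ultimately show ?thesis using that(2) y_def by blast
qed (use that(1) in \<open>auto simp: erm_def\<close>)

text \<open>The point of \<open>erm_S xs\<close> at which \<open>erm_min\<close> is read moves to
  the right with \<open>x\<close>, and left of \<open>Min (erm_S xs)\<close> the value is 0, the
  least possible.\<close>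

lemma erm_in_monoF:
  assumes "xs \<noteq> []"
  shows "erm xs \<in> monoF"
proof -
  note g = monoF_D[OF erm_min_properties(1)[OF assms]]
  have nonneg: "0 \<le> erm xs x" for x
    by (rule erm_cases[OF assms, of x]) (use g(1) in auto)
  have "erm xs x \<le> erm xs x'" if le: "x \<le> x'" for x x'
  proof (rule erm_cases[OF assms, of x])
    fix y assume y: "y \<in> erm_S xs" "y \<le> x" "erm xs x = erm_min xs y"
    have "Min (erm_S xs) \<le> x'" using y le erm_S_props(1)[of xs] by (meson Min_le order_trans)
    then have "erm xs x' = erm_min xs (Max {z \<in> erm_S xs. z \<le> x'})" by (simp add: erm_def)
    moreover have "y \<le> Max {z \<in> erm_S xs. z \<le> x'}"
      using y le erm_S_props(1)[of xs] by (intro Max_ge) auto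
    ultimately show ?thesis using y(3) g(2) by simp
  qed (use nonneg in auto)
  then show ?thesis using nonneg by (intro monoF_I)
qed

text \<open>Every point of \<open>erm_S xs\<close> lies below some observation, so monotonicity
  carries the bound from the observations to the whole extension.\<close>

lemma erm_le_Max:
  assumes "xs \<noteq> []"
  shows "erm xs x \<le> real (Max (set xs))"
proof (rule erm_cases[OF assms, of x])
  fix y assume y: "y \<in> erm_S xs" "erm xs x = erm_min xs y"
  obtain z where z: "z \<in> set xs" "y \<le> z" using erm_S_props(4)[OF y(1)] by blast
  have "erm_min xs y \<le> erm_min xs z"
    by (rule monoF_D(2)[OF erm_min_properties(1)[OF assms] z(2)])
  with erm_min_le_Max[OF assms z(1)] y show ?thesis by simp
qed auto

text \<open>The loss reads a function only at \<open>x\<close> and \<open>x - 1\<close> for observed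
  \<open>x\<close>, and these points lie in \<open>erm_S xs\<close>, where the extension changes
  nothing. For \<open>x = 0\<close> the second value is multiplied by 0.\<close>

lemma erm_minimizes:
  assumes "xs \<noteq> []" "f \<in> monoF"
  shows "emp_loss xs (erm xs) \<le> emp_loss xs f"
proof -
  have "emp_loss xs (erm xs) = emp_loss xs (erm_min xs)"
    unfolding emp_loss_def
  proof (intro arg_cong[of _ _ sum_list] map_cong refl)
    fix x assume x: "x \<in> set xs"
    then have "erm xs x = erm_min xs x" using erm_S_props(2)[of xs] erm_eq_erm_min by blast
    moreover have "real x * erm xs (x - 1) = real x * erm_min xs (x - 1)"
      using erm_eq_erm_min[OF erm_S_props(3)[OF x]] by (cases x) auto
    ultimately show "(erm xs x)\<^sup>2 - 2 * real x * erm xs (x - 1)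
      = (erm_min xs x)\<^sup>2 - 2 * real x * erm_min xs (x - 1)" by simp
  qed
  then show ?thesis using erm_min_properties(2)[OF assms] by simp
qed

text \<open>First-order optimality along the segment from the estimator to \<open>f\<close>, which stays in
  the convex class.\<close>
lemma erm_basic_inequality:
  assumes xs: "xs \<noteq> []" and f: "f \<in> monoF"
  defines "\<Delta> \<equiv> \<lambda>x. erm xs x - f x"
  shows "(\<Sum>x\<leftarrow>xs. (\<Delta> x)\<^sup>2) \<le> (\<Sum>x\<leftarrow>xs. real x * \<Delta> (x - 1) - f x * \<Delta> x)"
proof -
  \<comment> \<open>\<open>L\<close> is half the derivative of the loss at the estimator in the
    direction of \<open>f\<close>: since \<open>f x + \<Delta> x\<close> is the estimator itself,
    moving by \<open>t\<close> changes the loss by exactly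
    \<open>2 * t * L + t^2 * S\<close>.\<close>
  define L where "L = (\<Sum>x\<leftarrow>xs. real x * \<Delta> (x - 1) - (f x + \<Delta> x) * \<Delta> x)"
  define S where "S = (\<Sum>x\<leftarrow>xs. (\<Delta> x)\<^sup>2)"
  have expand: "0 \<le> 2 * t * L + t\<^sup>2 * S" if t: "0 < t" "t \<le> 1" for t
  proof -
    have "(\<lambda>x. erm xs x - t * \<Delta> x) \<in> monoF"
    proof -
      have conv: "erm xs x - t * \<Delta> x = (1 - t) * erm xs x + t * f x" for x
        by (simp add: \<Delta>_def algebra_simps)
      have "0 \<le> erm xs x - t * \<Delta> x" for x
        unfolding conv using t monoF_D(1)[OF erm_in_monoF[OF xs], of x] monoF_D(1)[OF f, of x]
        by simp
      moreover have "erm xs x - t * \<Delta> x \<le> erm xs y - t * \<Delta> y" if "x \<le> y" for x y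
        unfolding conv
        using t monoF_D(2)[OF erm_in_monoF[OF xs] that] monoF_D(2)[OF f that]
        by (simp add: add_mono mult_left_mono)
      ultimately show ?thesis by (rule monoF_I)
    qed
    then have "emp_loss xs (erm xs) \<le> emp_loss xs (\<lambda>x. erm xs x - t * \<Delta> x)"
      by (rule erm_minimizes[OF xs])
    moreover have "emp_loss xs (\<lambda>x. erm xs x - t * \<Delta> x)
        = emp_loss xs (erm xs) + 2 * t * L + t\<^sup>2 * S"
      unfolding emp_loss_def L_def S_def sum_list_const_mult[symmetric] sum_list_addf[symmetric]
      by (intro arg_cong[of _ _ sum_list] map_cong refl)
        (simp add: \<Delta>_def power2_eq_square algebra_simps)
    ultimately show ?thesis by simp
  qed
  have "0 \<le> L"
  proof (rule ccontr)
    assume "\<not> 0 \<le> L"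
    then have L: "L < 0" by simp
    \<comment> \<open>This \<open>t\<close> ensures \<open>t * S \<le> - L\<close>, so a negative
      linear term would outweigh the quadratic one; the 1 in the denominator covers
      \<open>S = 0\<close>.\<close>
    define t where "t = min 1 (- L / (1 + \<bar>S\<bar>))"
    have "0 < - L / (1 + \<bar>S\<bar>)" using L by (intro divide_pos_pos) auto
    then have t: "0 < t" "t \<le> 1" by (auto simp: t_def)
    have "t * S \<le> t * (1 + \<bar>S\<bar>)" using t by (intro mult_left_mono) auto
    also have "\<dots> \<le> - L / (1 + \<bar>S\<bar>) * (1 + \<bar>S\<bar>)"
      by (intro mult_right_mono) (auto simp: t_def)
    also have "\<dots> = - L" by simp
    finally have "2 * L + t * S < 0" using L by simp
    then have "t * (2 * L + t * S) < 0" using t by (simp add: mult_pos_neg)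
    with expand[OF t] show False by (simp add: power2_eq_square algebra_simps)
  qed
  moreover have "L = (\<Sum>x\<leftarrow>xs. real x * \<Delta> (x - 1) - f x * \<Delta> x) - S"
    unfolding L_def S_def sum_list_subtractf[symmetric]
    by (intro arg_cong[of _ _ sum_list] map_cong refl) (simp add: power2_eq_square algebra_simps)
  ultimately show ?thesis unfolding S_def by simp
qed

subsection \<open>Expectations over an i.i.d. sample\<close>

text \<open>Expectation under the product law, written as a weighted sum over lists to match
  \<open>erm_risk\<close>. Values in \<open>ennreal\<close> make linearity available without
  integrability conditions.\<close>

definition iid_exp :: "(nat \<Rightarrow> real) \<Rightarrow> nat \<Rightarrow> (nat list \<Rightarrow> ennreal) \<Rightarrow> ennreal" where
  "iid_exp p n F =
     (\<integral>\<^sup>+xs. ennreal (prod_list (map p xs)) * F xs \<partial>count_space {xs. length xs = n})"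

lemma iid_exp_mono:
  assumes "\<And>xs. length xs = n \<Longrightarrow> F xs \<le> G xs"
  shows "iid_exp p n F \<le> iid_exp p n G"
  unfolding iid_exp_def using assms by (intro nn_integral_mono mult_left_mono) auto

lemma iid_exp_cong:
  assumes "\<And>xs. length xs = n \<Longrightarrow> F xs = G xs"
  shows "iid_exp p n F = iid_exp p n G"
  unfolding iid_exp_def using assms by (intro nn_integral_cong) auto

lemma iid_exp_add: "iid_exp p n (\<lambda>xs. F xs + G xs) = iid_exp p n F + iid_exp p n G"
  unfolding iid_exp_def by (simp add: distrib_left nn_integral_add)

lemma iid_exp_cmult: "iid_exp p n (\<lambda>xs. c * F xs) = c * iid_exp p n F"
  unfolding iid_exp_def by (simp add: mult.left_commute nn_integral_cmult)

lemma iid_exp_sum: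
  "iid_exp p n (\<lambda>xs. \<Sum>i\<in>A. F i xs) = (\<Sum>i\<in>A. iid_exp p n (F i))"
  unfolding iid_exp_def by (simp add: sum_distrib_left nn_integral_sum)

lemma iid_exp_0: "iid_exp p 0 F = F []"
proof -
  have "{xs :: nat list. length xs = 0} = {[]}" by auto
  then show ?thesis
    unfolding iid_exp_def by (simp add: nn_integral_count_space_finite)
qed

text \<open>Conditioning on the first observation: nonempty lists are pairs of head and tail, and
  Tonelli applies on the countable product. All later moment computations are inductions over this
  recursion.\<close>

lemma iid_exp_Suc:
  assumes p: "\<And>x. 0 \<le> p x"
  shows "iid_exp p (Suc n) F = (\<Sum>x. ennreal (p x) * iid_exp p n (\<lambda>xs. F (x # xs)))"
proof -
  let ?L = "{xs :: nat list. length xs = n}"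
  let ?W = "\<lambda>xs. ennreal (prod_list (map p xs))"
  interpret sigma_finite_measure "count_space ?L"
    by (rule sigma_finite_measure_count_space_countable) auto
  have bij: "bij_betw (\<lambda>(x, xs). x # xs) (UNIV \<times> ?L) {xs :: nat list. length xs = Suc n}"
    by (rule bij_betwI[where g = "\<lambda>xs. (hd xs, tl xs)"]) (auto simp: length_Suc_conv)
  have pair: "count_space UNIV \<Otimes>\<^sub>M count_space ?L = count_space (UNIV \<times> ?L :: (nat \<times> nat list) set)"
    by (rule pair_measure_countable) auto
  have "iid_exp p (Suc n) F
      = (\<integral>\<^sup>+z. ?W (fst z # snd z) * F (fst z # snd z) \<partial>count_space (UNIV \<times> ?L))"
    unfolding iid_exp_def nn_integral_bij_count_space[OF bij, symmetric]
    by (simp add: case_prod_beta)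
  also have "\<dots> = (\<integral>\<^sup>+x. \<integral>\<^sup>+xs. ?W (x # xs) * F (x # xs) \<partial>count_space ?L \<partial>count_space UNIV)"
    unfolding pair[symmetric] by (subst nn_integral_fst[symmetric]) (auto simp: pair)
  also have "\<dots> = (\<integral>\<^sup>+x. ennreal (p x) * iid_exp p n (\<lambda>xs. F (x # xs)) \<partial>count_space UNIV)"
    unfolding iid_exp_def
    by (simp add: nn_integral_cmult[symmetric] ennreal_mult' p mult.assoc)
  finally show ?thesis by (simp add: nn_integral_count_space_nat)
qed

lemma suminf_ennreal_sums:
  assumes "f sums l" "\<And>i. 0 \<le> f i"
  shows "(\<Sum>i. ennreal (f i)) = ennreal l"
  using assms by (intro sums_unique[symmetric] sums_ennreal[THEN iffD2])
    (auto intro: sums_le[OF _ sums_zero])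

context
  fixes p :: "nat \<Rightarrow> real"
  assumes p_nonneg: "\<And>x. 0 \<le> p x" and p_sums: "p sums 1"
begin

lemma suminf_p: "(\<Sum>x. ennreal (p x)) = 1"
  using suminf_ennreal_sums[OF p_sums p_nonneg] by simp

lemma iid_exp_const: "iid_exp p n (\<lambda>_. c) = c"
proof (induction n)
  case (Suc n)
  then show ?case
    by (simp add: iid_exp_Suc p_nonneg ennreal_suminf_multc suminf_p)
qed (simp add: iid_exp_0)

lemma iid_exp_sum_list:
  assumes "\<And>x. 0 \<le> \<phi> x"
  shows "iid_exp p n (\<lambda>xs. ennreal (\<Sum>x\<leftarrow>xs. \<phi> x)) = of_nat n * (\<Sum>x. ennreal (p x * \<phi> x))"
proof (induction n)
  case (Suc n)
  let ?m = "\<Sum>x. ennreal (p x * \<phi> x)"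
  have "iid_exp p (Suc n) (\<lambda>xs. ennreal (\<Sum>x\<leftarrow>xs. \<phi> x))
      = (\<Sum>x. ennreal (p x) * (ennreal (\<phi> x) + of_nat n * ?m))"
  proof -
    have "ennreal (\<phi> x + (\<Sum>x\<leftarrow>xs. \<phi> x)) = ennreal (\<phi> x) + ennreal (\<Sum>x\<leftarrow>xs. \<phi> x)" for x xs
      using assms by (intro ennreal_plus sum_list_nonneg) auto
    then show ?thesis
      by (simp only: iid_exp_Suc p_nonneg list.map sum_list.Cons iid_exp_add iid_exp_const Suc)
  qed
  also have "\<dots> = (\<Sum>x. ennreal (p x * \<phi> x) + ennreal (p x) * (of_nat n * ?m))"
    by (simp add: distrib_left ennreal_mult' p_nonneg)
  also have "\<dots> = ?m + of_nat n * ?m"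
    by (subst suminf_add[symmetric]) (auto simp: ennreal_suminf_multc suminf_p)
  finally show ?case by (simp add: distrib_right)
qed (simp add: iid_exp_0)

lemma iid_exp_prod_list:
  assumes g: "\<And>x. 0 \<le> g x" and s: "(\<lambda>x. p x * g x) sums l"
  shows "iid_exp p n (\<lambda>xs. ennreal (prod_list (map g xs))) = ennreal (l ^ n)"
proof (induction n)
  case (Suc n)
  have l: "0 \<le> l" using s by (rule sums_le[OF _ sums_zero, rotated]) (simp add: g p_nonneg)
  have "iid_exp p (Suc n) (\<lambda>xs. ennreal (prod_list (map g xs)))
      = (\<Sum>x. ennreal (p x * g x) * ennreal (l ^ n))"
    by (simp add: iid_exp_Suc p_nonneg g ennreal_mult' iid_exp_cmult Suc mult.assoc)
  also have "\<dots> = ennreal l * ennreal (l ^ n)"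
    by (simp only: ennreal_suminf_multc suminf_ennreal_sums[OF s] g p_nonneg mult_nonneg_nonneg)
  finally show ?case by (simp add: ennreal_mult' l)
qed (simp add: iid_exp_0)

text \<open>Squared mean plus variance, with each variance bounded by the second moment
  \<open>v\<close>. The offset \<open>c\<close> is there for the induction, where it absorbs the
  value of the first observation.\<close>

lemma iid_exp_square_sum_list:
  assumes \<mu>: "(\<lambda>x. p x * \<psi> x) sums \<mu>" and v: "(\<lambda>x. p x * (\<psi> x)\<^sup>2) sums v"
  shows "iid_exp p n (\<lambda>xs. ennreal ((c + (\<Sum>x\<leftarrow>xs. \<psi> x))\<^sup>2))
    \<le> ennreal ((c + real n * \<mu>)\<^sup>2 + real n * v)"
proof (induction n arbitrary: c)
  case (Suc n)
  have v0: "0 \<le> v" using v by (rule sums_le[OF _ sums_zero, rotated]) (simp add: p_nonneg)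
  define d where "d = c + real n * \<mu>"
  have s: "(\<lambda>x. p x * ((d + \<psi> x)\<^sup>2 + real n * v)) sums ((d\<^sup>2 + real n * v) * 1 + (2 * d * \<mu> + v))"
    using sums_add[OF sums_mult[OF p_sums, of "d\<^sup>2 + real n * v"]
        sums_add[OF sums_mult[OF \<mu>, of "2 * d"] v]]
    by (simp add: power2_eq_square algebra_simps)
  have "iid_exp p (Suc n) (\<lambda>xs. ennreal ((c + (\<Sum>x\<leftarrow>xs. \<psi> x))\<^sup>2))
      = (\<Sum>x. ennreal (p x) * iid_exp p n (\<lambda>xs. ennreal (((c + \<psi> x) + (\<Sum>x\<leftarrow>xs. \<psi> x))\<^sup>2)))"
    by (simp add: iid_exp_Suc p_nonneg add.assoc)
  also have "\<dots> \<le> (\<Sum>x. ennreal (p x) * ennreal (((c + \<psi> x) + real n * \<mu>)\<^sup>2 + real n * v))"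
    by (intro suminf_le mult_left_mono Suc) auto
  also have "\<dots> = (\<Sum>x. ennreal (p x * ((d + \<psi> x)\<^sup>2 + real n * v)))"
    by (intro arg_cong[of _ _ suminf] ext)
      (simp add: ennreal_mult'[OF p_nonneg, symmetric] d_def add_ac)
  also have "\<dots> = ennreal ((d\<^sup>2 + real n * v) * 1 + (2 * d * \<mu> + v))"
    by (intro suminf_ennreal_sums s) (use v0 in \<open>simp add: p_nonneg\<close>)
  also have "\<dots> \<le> ennreal ((c + real (Suc n) * \<mu>)\<^sup>2 + real (Suc n) * v)"
  proof (rule ennreal_leI)
    have "c + real (Suc n) * \<mu> = d + \<mu>" by (simp add: d_def algebra_simps)
    then show "(d\<^sup>2 + real n * v) * 1 + (2 * d * \<mu> + v)
        \<le> (c + real (Suc n) * \<mu>)\<^sup>2 + real (Suc n) * v"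
      by (simp add: power2_eq_square algebra_simps)
  qed
  finally show ?case .
qed (simp add: iid_exp_0)

text \<open>The deviation \<open>(u - 2N)\<^sub>+\<close> is at most \<open>u\<close> times \<open>2\<close> to the power \<open>u/2 - N\<close>, whose
  expectation factorises; the rational bound is chosen because it telescopes when \<open>u\<close> at least
  halves from one point to the next.\<close>
lemma iid_exp_undercount:
  fixes n :: nat and x :: nat
  defines "u \<equiv> \<lambda>x. real n * p x"
  shows "iid_exp p n (\<lambda>xs. ennreal (max 0 (u x - 2 * real (count_list xs x))))
    \<le> ennreal (600 * u x / ((1 + u x) * (2 + u x)))"
proof -
  define g :: "nat \<Rightarrow> real" where "g = (\<lambda>y. if y = x then 1/2 else 1)"
  define q where "q = u x"
  have q0: "0 \<le> q" by (simp add: q_def u_def p_nonneg)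
  have prod: "prod_list (map g xs) = (1/2) ^ count_list xs x" for xs
    by (induction xs) (auto simp: g_def)
  have s: "(\<lambda>y. p y * g y) sums (1 + - p x / 2)"
    using sums_add[OF p_sums sums_single[of x "\<lambda>y. - p y / 2"]]
    by (rule sums_cong[THEN iffD1, rotated]) (auto simp: g_def)
  have pw: "max 0 (q - 2 * real (count_list xs x)) \<le> q * 2 powr (q / 2) * prod_list (map g xs)" for xs
  proof (cases "q \<le> 2 * real (count_list xs x)")
    case True
    then show ?thesis using q0 by (simp add: prod)
  next
    case False
    have "1 \<le> 2 powr (q / 2 - real (count_list xs x))"
      using False by (intro ge_one_powr_ge_zero) auto
    also have "\<dots> = 2 powr (q / 2) * prod_list (map g xs)"
      by (simp add: powr_diff powr_realpow prod power_one_over)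
    finally have "q * 1 \<le> q * (2 powr (q / 2) * prod_list (map g xs))"
      using q0 by (intro mult_left_mono)
    moreover have "max 0 (q - 2 * real (count_list xs x)) \<le> q" using q0 by simp
    ultimately show ?thesis by (simp only: mult.assoc mult_1_right)
  qed
  have px: "p x \<le> 1"
    using sum_le_suminf[OF sums_summable[OF p_sums], of "{x}"] p_nonneg sums_unique[OF p_sums] by auto
  have "iid_exp p n (\<lambda>xs. ennreal (max 0 (q - 2 * real (count_list xs x))))
      \<le> iid_exp p n (\<lambda>xs. ennreal (q * 2 powr (q / 2)) * ennreal (prod_list (map g xs)))"
    by (intro iid_exp_mono) (subst ennreal_mult'[symmetric], use q0 pw in \<open>auto intro: ennreal_leI\<close>)
  also have "\<dots> = ennreal (q * 2 powr (q / 2)) * ennreal ((1 + - p x / 2) ^ n)"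
    unfolding iid_exp_cmult by (subst iid_exp_prod_list[OF _ s]) (auto simp: g_def)
  also have "\<dots> = ennreal (q * 2 powr (q / 2) * (1 + - p x / 2) ^ n)"
    using q0 by (simp add: ennreal_mult')
  also have "\<dots> \<le> ennreal (600 * q / ((1 + q) * (2 + q)))"
  proof (rule ennreal_leI)
    have "(1 + - p x / 2) ^ n \<le> exp (- p x / 2) ^ n"
      using px by (intro power_mono exp_ge_add_one_self) auto
    also have "\<dots> = exp (- (q / 2))"
      by (simp add: q_def u_def exp_of_nat_mult[symmetric])
    finally have a: "(1 + - p x / 2) ^ n \<le> exp (- (q / 2))" .
    \<comment> \<open>Using 0.7 for \<open>ln 2\<close>, the factor \<open>2 powr (q / 2)\<close>
      costs at most \<open>exp (0.35 * q)\<close> out of the available \<open>exp (- q / 2)\<close>.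
      What remains is \<open>exp (- y)\<close> with \<open>y = 0.15 * q\<close>; its quadratic
      Taylor bound beats the rational function, and 600 is a generous constant for this.\<close>
    have "ln 2 \<le> (0.7 :: real)"
      by (rule order_trans[OF ln2_le_25_over_36]) simp
    then have "q / 2 * ln 2 \<le> q / 2 * 0.7" using q0 by (intro mult_left_mono) auto
    then have b: "2 powr (q / 2) \<le> exp (0.35 * q)" by (simp add: powr_def)
    define y where "y = 0.15 * q"
    have "1 + y + y\<^sup>2 / 2 \<le> exp y" using exp_lower_Taylor_quadratic[of y] q0 by (simp add: y_def)
    moreover have "y\<^sup>2 / 2 = 9 / 800 * q\<^sup>2" by (simp add: y_def power2_eq_square)
    ultimately have "1 + 3 / 20 * q + 9 / 800 * q\<^sup>2 \<le> exp y" by (simp add: y_def)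
    moreover have "(1 + q) * (2 + q) = 2 + 3 * q + q\<^sup>2"
      by (simp add: power2_eq_square algebra_simps)
    ultimately have le: "(1 + q) * (2 + q) \<le> 600 * exp y"
      using q0 zero_le_power2[of q] by linarith
    have c: "exp (- y) \<le> 600 / ((1 + q) * (2 + q))"
    proof -
      have "0 < (1 + q) * (2 + q)" using q0 by (intro mult_pos_pos) auto
      then show ?thesis
        using le by (simp only: exp_minus inverse_eq_divide pos_le_divide_eq times_divide_eq_left
            mult_1 pos_divide_le_eq exp_gt_zero)
    qed
    have "q * 2 powr (q / 2) * (1 + - p x / 2) ^ n \<le> q * exp (0.35 * q) * exp (- (q / 2))"
      using a b q0 px by (intro mult_mono) auto
    also have "\<dots> = q * exp (- y)" by (simp add: mult.assoc exp_add[symmetric] y_def)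
    also have "\<dots> \<le> q * (600 / ((1 + q) * (2 + q)))" using c q0 by (intro mult_left_mono)
    finally show "q * 2 powr (q / 2) * (1 + - p x / 2) ^ n \<le> 600 * q / ((1 + q) * (2 + q))"
      by (simp add: mult.commute)
  qed
  finally show ?thesis by (simp add: q_def)
qed

end

text \<open>Each term equals \<open>a / (1 + a) - a / (2 + a)\<close>. If the next value
  \<open>b\<close> is at most \<open>a / 2\<close>, then
  \<open>b / (1 + b) \<le> a / (2 + a)\<close>, so the sum telescopes. The bound does not depend on
  how large \<open>u k\<close> is.\<close>

lemma sum_geometric_decay_bound:
  fixes u :: "nat \<Rightarrow> real"
  assumes "\<And>x. 0 \<le> u x" and "\<And>x. k \<le> x \<Longrightarrow> u (Suc x) \<le> u x / 2"
  shows "(\<Sum>x\<in>{k..<k+j}. u x / ((1 + u x) * (2 + u x))) \<le> 1 - u (k+j) / (1 + u (k+j))"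
proof (induction j)
  case 0
  then show ?case using assms(1)[of k] by simp
next
  case (Suc j)
  let ?a = "u (k + j)" and ?b = "u (Suc (k + j))"
  have nn: "0 \<le> ?a" "0 \<le> ?b" and half: "?b \<le> ?a / 2" using assms by auto
  have "?b / (1 + ?b) \<le> ?a / (2 + ?a)" using nn half by (simp add: field_simps)
  moreover have "?a / ((1 + ?a) * (2 + ?a)) = ?a / (1 + ?a) - ?a / (2 + ?a)"
    using nn by (simp add: field_simps)
  ultimately have "?a / ((1 + ?a) * (2 + ?a)) \<le> ?a / (1 + ?a) - ?b / (1 + ?b)" by simp
  then show ?case using Suc by simp
qed

subsection \<open>Poisson mixtures\<close>

lemma poi_nonneg: "0 \<le> \<theta> \<Longrightarrow> 0 \<le> poi \<theta> x"
  by (simp add: poi_def)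

lemma poi_power_sums: "(\<lambda>x. poi \<theta> x * z ^ x) sums exp (\<theta> * (z - 1))"
proof -
  have "(\<lambda>x. exp (- \<theta>) * ((\<theta> * z) ^ x /\<^sub>R fact x)) sums (exp (- \<theta>) * exp (\<theta> * z))"
    by (intro sums_mult exp_converges)
  moreover have "exp (- \<theta>) * exp (\<theta> * z) = exp (\<theta> * (z - 1))"
    by (simp add: exp_add[symmetric] algebra_simps)
  ultimately show ?thesis
    by (simp add: poi_def power_mult_distrib divide_inverse mult_ac)
qed

lemma poi_sums: "poi \<theta> sums 1"
  using poi_power_sums[of \<theta> 1] by simp

lemma poi_le_1:
  assumes "0 \<le> \<theta>"
  shows "poi \<theta> x \<le> 1"
  using sum_le_suminf[OF sums_summable[OF poi_sums], of "{x}" \<theta>] poi_nonneg[OF assms]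
    sums_unique[OF poi_sums, of \<theta>] by auto

text \<open>Multiplication by the parameter is a shift of the observation. This identity yields all
  posterior moments, and with them the formula for the Bayes estimator.\<close>

lemma poi_mult: "poi \<theta> x * \<theta> = real (x + 1) * poi \<theta> (x + 1)"
  by (simp add: poi_def field_simps del: of_nat_Suc)

locale prior = prob_space \<pi> for \<pi> :: "real measure" +
  assumes sets_prior: "sets \<pi> = sets borel"
    and prior_nonneg: "AE \<theta> in \<pi>. 0 \<le> \<theta>"
begin

abbreviation "p \<equiv> pmix \<pi>"
abbreviation "fstar \<equiv> bayes_est \<pi>"

lemma measurable_prior [measurable_cong]: "sets \<pi> = sets borel"
  by (rule sets_prior)

lemma measurable_poi [measurable]: "(\<lambda>\<theta>. poi \<theta> x) \<in> borel_measurable \<pi>"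
  unfolding poi_def by measurable

text \<open>Each power of the parameter is traded for a shift in \<open>x\<close>, down to the
  bounded Poisson weight itself.\<close>

lemma integrable_poi_power: "integrable \<pi> (\<lambda>\<theta>. poi \<theta> x * \<theta> ^ k)"
proof (induction k arbitrary: x)
  case 0
  show ?case
    by (rule integrable_const_bound[where B = 1], use prior_nonneg in eventually_elim)
      (auto simp: poi_nonneg poi_le_1)
next
  case (Suc k)
  have "poi \<theta> x * \<theta> ^ Suc k = real (x + 1) * (poi \<theta> (x + 1) * \<theta> ^ k)" for \<theta>
    using poi_mult[of \<theta> x] by (simp add: mult.assoc[symmetric])
  then show ?case using Suc[of "x + 1"] by (simp only: integrable_mult_right)
qed

lemma integrable_poi [simp]: "integrable \<pi> (\<lambda>\<theta>. poi \<theta> x)"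
  using integrable_poi_power[of x 0] by simp

lemma integrable_poi_mult [simp]: "integrable \<pi> (\<lambda>\<theta>. poi \<theta> x * \<theta>)"
  using integrable_poi_power[of x 1] by simp

lemma integrable_poi_square [simp]: "integrable \<pi> (\<lambda>\<theta>. poi \<theta> x * \<theta>\<^sup>2)"
  by (rule integrable_poi_power)

lemma pmix_nonneg: "0 \<le> p x"
  unfolding pmix_def by (rule integral_nonneg_AE, use prior_nonneg in eventually_elim) (rule poi_nonneg)

lemma suminf_pmix_mult:
  assumes c: "\<And>x. 0 \<le> c x"
  shows "(\<Sum>x. ennreal (p x * c x)) = (\<integral>\<^sup>+\<theta>. (\<Sum>x. ennreal (poi \<theta> x * c x)) \<partial>\<pi>)"
proof -
  have "ennreal (p x * c x) = (\<integral>\<^sup>+\<theta>. ennreal (poi \<theta> x * c x) \<partial>\<pi>)" for x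
  proof -
    have "(\<integral>\<^sup>+\<theta>. ennreal (poi \<theta> x * c x) \<partial>\<pi>) = ennreal (\<integral>\<theta>. poi \<theta> x * c x \<partial>\<pi>)"
      by (rule nn_integral_eq_integral, simp, use prior_nonneg in eventually_elim)
        (simp add: poi_nonneg c)
    then show ?thesis by (simp add: pmix_def)
  qed
  then show ?thesis by (simp add: nn_integral_suminf)
qed

lemma suminf_pmix_power:
  assumes z: "0 \<le> z"
  shows "(\<Sum>x. ennreal (p x * z ^ x)) = (\<integral>\<^sup>+\<theta>. ennreal (exp (\<theta> * (z - 1))) \<partial>\<pi>)"
proof -
  have "(\<Sum>x. ennreal (p x * z ^ x)) = (\<integral>\<^sup>+\<theta>. (\<Sum>x. ennreal (poi \<theta> x * z ^ x)) \<partial>\<pi>)"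
    using z by (intro suminf_pmix_mult) simp
  also have "\<dots> = (\<integral>\<^sup>+\<theta>. ennreal (exp (\<theta> * (z - 1))) \<partial>\<pi>)"
    by (rule nn_integral_cong_AE, use prior_nonneg in eventually_elim)
      (intro suminf_ennreal_sums[OF poi_power_sums] mult_nonneg_nonneg poi_nonneg zero_le_power z)
  finally show ?thesis .
qed

lemma pmix_sums: "p sums 1"
proof -
  have s: "(\<Sum>x. ennreal (p x)) = 1"
    using suminf_pmix_power[of 1] by (simp add: emeasure_space_1)
  have "summable p"
    by (rule summable_suminf_not_top) (use s pmix_nonneg in auto)
  then have "p sums suminf p" by (rule summable_sums)
  moreover have "ennreal (suminf p) = 1"
    using s suminf_ennreal2[OF pmix_nonneg \<open>summable p\<close>] by simp
  then have "suminf p = 1" by (simp add: ennreal_eq_1)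
  ultimately show ?thesis by simp
qed

lemma pmix_mean: "(\<integral>\<theta>. poi \<theta> x * \<theta> \<partial>\<pi>) = real (x + 1) * p (x + 1)"
  unfolding poi_mult pmix_def by simp

lemma pmix_second: "(\<integral>\<theta>. poi \<theta> x * \<theta>\<^sup>2 \<partial>\<pi>) = real (x + 1) * (real (x + 2) * p (x + 2))"
proof -
  have "poi \<theta> x * \<theta>\<^sup>2 = real (x + 1) * (poi \<theta> (x + 1) * \<theta>)" for \<theta>
    using poi_mult[of \<theta> x] by (simp add: power2_eq_square mult.assoc[symmetric])
  then show ?thesis using pmix_mean[of "x + 1"] by simp
qed

text \<open>If \<open>p x = 0\<close>, the Poisson weight at \<open>x\<close> vanishes almost
  surely, and by \<open>poi_mult\<close> so does the one at \<open>x + 1\<close>. This makes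
  \<open>pmix_fstar\<close> hold also where \<open>bayes_est\<close> divides by zero.\<close>

lemma pmix_Suc_eq_0:
  assumes "p x = 0"
  shows "p (x + 1) = 0"
proof -
  have nn: "AE \<theta> in \<pi>. 0 \<le> poi \<theta> x" using prior_nonneg by eventually_elim (rule poi_nonneg)
  have "AE \<theta> in \<pi>. poi \<theta> x = 0"
    using assms integral_nonneg_eq_0_iff_AE[OF integrable_poi nn] by (simp add: pmix_def)
  then have "AE \<theta> in \<pi>. poi \<theta> (x + 1) = 0"
  proof eventually_elim
    case (elim \<theta>)
    then have "real (x + 1) * poi \<theta> (x + 1) = 0" using poi_mult[of \<theta> x] by simp
    then show ?case by simp
  qed
  then show ?thesis unfolding pmix_def by (rule integral_eq_zero_AE)
qed

lemma pmix_fstar: "p x * fstar x = real (x + 1) * p (x + 1)"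
proof (cases "p x = 0")
  case True
  then show ?thesis using pmix_Suc_eq_0 by simp
qed (simp add: bayes_est_def)

lemma fstar_nonneg: "0 \<le> fstar x"
  unfolding bayes_est_def by (simp add: pmix_nonneg)

text \<open>The second moment is obtained by two shifts and expressed through \<open>fstar\<close>
  at the next point. The same formula serves the monotonicity of \<open>fstar\<close> and the
  decomposition of the risk.\<close>

lemma integral_poi_quadratic:
  "(\<integral>\<theta>. poi \<theta> x * (c - \<theta>)\<^sup>2 \<partial>\<pi>)
    = p x * c\<^sup>2 - 2 * c * (p x * fstar x) + real (x + 1) * (p (x + 1) * fstar (x + 1))"
proof -
  have "poi \<theta> x * (c - \<theta>)\<^sup>2 = poi \<theta> x * c\<^sup>2 - 2 * c * (poi \<theta> x * \<theta>) + poi \<theta> x * \<theta>\<^sup>2" for \<theta>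
    by (simp add: power2_eq_square algebra_simps)
  then have "(\<integral>\<theta>. poi \<theta> x * (c - \<theta>)\<^sup>2 \<partial>\<pi>)
      = (\<integral>\<theta>. poi \<theta> x * c\<^sup>2 \<partial>\<pi>) - 2 * c * (\<integral>\<theta>. poi \<theta> x * \<theta> \<partial>\<pi>) + (\<integral>\<theta>. poi \<theta> x * \<theta>\<^sup>2 \<partial>\<pi>)"
    by simp
  then show ?thesis
    unfolding pmix_mean pmix_second pmix_fstar by (simp add: pmix_def)
qed

lemma integrable_poi_quadratic: "integrable \<pi> (\<lambda>\<theta>. poi \<theta> x * (c - \<theta>)\<^sup>2)"
proof -
  have "poi \<theta> x * (c - \<theta>)\<^sup>2 = poi \<theta> x * c\<^sup>2 - 2 * c * (poi \<theta> x * \<theta>) + poi \<theta> x * \<theta>\<^sup>2" for \<theta>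
    by (simp add: power2_eq_square algebra_simps)
  then show ?thesis by simp
qed

lemma integral_poi_quadratic_nonneg: "0 \<le> (\<integral>\<theta>. poi \<theta> x * (c - \<theta>)\<^sup>2 \<partial>\<pi>)"
  by (rule integral_nonneg_AE, use prior_nonneg in eventually_elim) (simp add: poi_nonneg)

text \<open>Nonnegativity of the posterior variance at \<open>x\<close> compares consecutive posterior means.\<close>
lemma fstar_mono: "mono fstar"
proof (rule mono_iff_le_Suc[THEN iffD2], rule allI)
  fix x
  let ?b = "fstar x"
  show "?b \<le> fstar (Suc x)"
  proof (cases "p (x + 1) = 0")
    case True
    then show ?thesis using fstar_nonneg[of "Suc x"] by (simp add: bayes_est_def)
  next
    case False
    have "0 \<le> p x * ?b\<^sup>2 - 2 * ?b * (p x * ?b) + real (x + 1) * (p (x + 1) * fstar (x + 1))"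
      using integral_poi_quadratic_nonneg[of x ?b] unfolding integral_poi_quadratic .
    also have "\<dots> = real (x + 1) * (p (x + 1) * fstar (x + 1)) - ?b * (p x * ?b)"
      by (simp add: power2_eq_square algebra_simps)
    also have "\<dots> = real (x + 1) * p (x + 1) * (fstar (x + 1) - ?b)"
      by (simp only: pmix_fstar[of x]) (simp add: algebra_simps)
    finally have "0 \<le> real (x + 1) * p (x + 1) * (fstar (x + 1) - ?b)" .
    moreover have "0 < real (x + 1) * p (x + 1)"
      using False pmix_nonneg[of "x + 1"] by (intro mult_pos_pos) auto
    ultimately show ?thesis by (simp add: zero_le_mult_iff)
  qed
qed

section \<open>Excess risk and tail estimates for the mixture\<close>

lemma test_risk_eq: "test_risk \<pi> f = (\<Sum>x. ennreal (\<integral>\<theta>. poi \<theta> x * (f x - \<theta>)\<^sup>2 \<partial>\<pi>))"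
proof -
  have "(\<integral>\<^sup>+\<theta>. ennreal (poi \<theta> x * (f x - \<theta>)\<^sup>2) \<partial>\<pi>)
      = ennreal (\<integral>\<theta>. poi \<theta> x * (f x - \<theta>)\<^sup>2 \<partial>\<pi>)" for x
    by (rule nn_integral_eq_integral[OF integrable_poi_quadratic],
        use prior_nonneg in eventually_elim) (simp add: poi_nonneg)
  then show ?thesis
    unfolding test_risk_def by (subst nn_integral_suminf) auto
qed

text \<open>Pythagoras at each \<open>x\<close>: the cross term vanishes because
  \<open>fstar x\<close> is the posterior mean. The additive form avoids subtracting possibly
  infinite risks.\<close>

lemma test_risk_decomposition:
  "test_risk \<pi> f = test_risk \<pi> fstar + (\<Sum>x. ennreal (p x * (f x - fstar x)\<^sup>2))"
proof -
  have "(\<integral>\<theta>. poi \<theta> x * (f x - \<theta>)\<^sup>2 \<partial>\<pi>)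
      = (\<integral>\<theta>. poi \<theta> x * (fstar x - \<theta>)\<^sup>2 \<partial>\<pi>) + p x * (f x - fstar x)\<^sup>2" for x
    unfolding integral_poi_quadratic by (simp add: power2_eq_square algebra_simps)
  then show ?thesis
    unfolding test_risk_eq
    by (subst suminf_add) (auto simp: ennreal_plus integral_poi_quadratic_nonneg pmix_nonneg)
qed

text \<open>Conditional Jensen for the convex function sending \<open>t\<close> to the square of
  \<open>max 0 (t - T)\<close>, applied to the posterior at each \<open>x\<close> and then summed
  over \<open>x\<close>.\<close>

lemma suminf_excess_fstar:
  "(\<Sum>x. ennreal (p x * (max 0 (fstar x - T))\<^sup>2)) \<le> (\<integral>\<^sup>+\<theta>. ennreal ((max 0 (\<theta> - T))\<^sup>2) \<partial>\<pi>)"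
proof -
  have "ennreal (p x * (max 0 (fstar x - T))\<^sup>2)
      \<le> (\<integral>\<^sup>+\<theta>. ennreal (poi \<theta> x * (max 0 (\<theta> - T))\<^sup>2) \<partial>\<pi>)" for x
  proof -
    define a where "a = max 0 (fstar x - T)"
    have a: "0 \<le> a" "a * (fstar x - T) = a * a" by (auto simp: a_def max_def)
    have int: "integrable \<pi> (\<lambda>\<theta>. poi \<theta> x * (max 0 (\<theta> - T))\<^sup>2)"
    proof (rule Bochner_Integration.integrable_bound[OF integrable_poi_quadratic[of x T]])
      show "AE \<theta> in \<pi>. norm (poi \<theta> x * (max 0 (\<theta> - T))\<^sup>2) \<le> norm (poi \<theta> x * (T - \<theta>)\<^sup>2)"
        by (auto simp: abs_mult max_def power2_commute intro!: AE_I2)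
    qed measurable
    have "p x * a\<^sup>2 = 2 * a * (p x * fstar x) - (2 * a * T + a\<^sup>2) * p x"
    proof -
      have "2 * a * (p x * fstar x) - (2 * a * T + a\<^sup>2) * p x
          = p x * (2 * (a * (fstar x - T)) - a\<^sup>2)"
        by (simp add: algebra_simps)
      then show ?thesis unfolding a(2) by (simp add: power2_eq_square)
    qed
    also have "\<dots> = (\<integral>\<theta>. 2 * a * (poi \<theta> x * \<theta>) - (2 * a * T + a\<^sup>2) * poi \<theta> x \<partial>\<pi>)"
      by (simp add: pmix_mean pmix_fstar) (simp add: pmix_def)
    also have "\<dots> \<le> (\<integral>\<theta>. poi \<theta> x * (max 0 (\<theta> - T))\<^sup>2 \<partial>\<pi>)"
    proof (rule integral_mono_AE[OF _ int])
      show "AE \<theta> in \<pi>. 2 * a * (poi \<theta> x * \<theta>) - (2 * a * T + a\<^sup>2) * poi \<theta> x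
          \<le> poi \<theta> x * (max 0 (\<theta> - T))\<^sup>2"
        using prior_nonneg
      proof eventually_elim
        case (elim \<theta>)
        \<comment> \<open>The tangent line at the posterior mean lies below the convex function;
          this replaces an appeal to Jensen's inequality.\<close>
        have "2 * a * (\<theta> - T) - a\<^sup>2 \<le> (max 0 (\<theta> - T))\<^sup>2"
        proof -
          have "0 \<le> (max 0 (\<theta> - T) - a)\<^sup>2" by simp
          moreover have "a * (\<theta> - T) \<le> a * max 0 (\<theta> - T)" using a by (intro mult_left_mono) auto
          ultimately show ?thesis by (simp add: power2_eq_square algebra_simps)
        qed
        then have "poi \<theta> x * (2 * a * (\<theta> - T) - a\<^sup>2) \<le> poi \<theta> x * (max 0 (\<theta> - T))\<^sup>2"
          using poi_nonneg[OF elim] by (rule mult_left_mono)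
        then show ?case by (simp add: algebra_simps)
      qed
    qed simp
    finally have "ennreal (p x * a\<^sup>2) \<le> ennreal (\<integral>\<theta>. poi \<theta> x * (max 0 (\<theta> - T))\<^sup>2 \<partial>\<pi>)"
      by (rule ennreal_leI)
    also have "\<dots> = (\<integral>\<^sup>+\<theta>. ennreal (poi \<theta> x * (max 0 (\<theta> - T))\<^sup>2) \<partial>\<pi>)"
      by (rule nn_integral_eq_integral[OF int, symmetric], use prior_nonneg in eventually_elim)
        (simp add: poi_nonneg)
    finally show ?thesis by (simp add: a_def)
  qed
  then have "(\<Sum>x. ennreal (p x * (max 0 (fstar x - T))\<^sup>2))
      \<le> (\<Sum>x. \<integral>\<^sup>+\<theta>. ennreal (poi \<theta> x * (max 0 (\<theta> - T))\<^sup>2) \<partial>\<pi>)"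
    by (intro suminf_le) auto
  also have "\<dots> = (\<integral>\<^sup>+\<theta>. (\<Sum>x. ennreal (poi \<theta> x * (max 0 (\<theta> - T))\<^sup>2)) \<partial>\<pi>)"
    by (subst nn_integral_suminf) auto
  also have "\<dots> = (\<integral>\<^sup>+\<theta>. ennreal ((max 0 (\<theta> - T))\<^sup>2) \<partial>\<pi>)"
    by (rule nn_integral_cong_AE, use prior_nonneg in eventually_elim)
      (intro suminf_ennreal_sums sums_mult2[OF poi_sums, simplified mult_1] mult_nonneg_nonneg
        poi_nonneg zero_le_power2)
  finally show ?thesis .
qed

text \<open>A Chernoff bound with two rates: \<open>a\<close> pays for the factor
  \<open>x^2\<close>, and \<open>b\<close> produces the decay in \<open>m\<close>. The generating
  function of the mixture then becomes an exponential moment of the prior.\<close>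

lemma suminf_tail_second_moment:
  assumes a: "0 < a" and b: "0 \<le> b"
  shows "(\<Sum>x. ennreal (p x * (if m < x then (real x)\<^sup>2 else 0)))
    \<le> ennreal (2 / a\<^sup>2 * exp (- b * real m)) * (\<integral>\<^sup>+\<theta>. ennreal (exp (\<theta> * (exp (a + b) - 1))) \<partial>\<pi>)"
proof -
  define K where "K = 2 / a\<^sup>2 * exp (- b * real m)"
  have K: "0 \<le> K" by (simp add: K_def)
  have pt: "(if m < x then (real x)\<^sup>2 else 0) \<le> K * exp (a + b) ^ x" for x
  proof (cases "m < x")
    case True
    have "(a * real x)\<^sup>2 / 2 \<le> exp (a * real x)"
    proof -
      have "0 \<le> a * real x" using a by simp
      with exp_lower_Taylor_quadratic[OF this] show ?thesis by linarith
    qed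
    then have "(real x)\<^sup>2 \<le> 2 / a\<^sup>2 * exp (a * real x)"
      using a by (simp add: field_simps power2_eq_square)
    also have "\<dots> \<le> 2 / a\<^sup>2 * exp (a * real x + b * (real x - real m))"
      using True b by (intro mult_left_mono) auto
    also have "a * real x + b * (real x - real m) = - b * real m + real x * (a + b)"
      by (simp add: algebra_simps)
    also have "2 / a\<^sup>2 * exp \<dots> = K * exp (a + b) ^ x"
      by (simp only: K_def exp_add exp_of_nat_mult mult.assoc)
    finally show ?thesis using True by simp
  qed (use K in simp)
  have "(\<Sum>x. ennreal (p x * (if m < x then (real x)\<^sup>2 else 0)))
      \<le> (\<Sum>x. ennreal K * ennreal (p x * exp (a + b) ^ x))"
  proof (intro suminf_le)
    fix x
    have "p x * (if m < x then (real x)\<^sup>2 else 0) \<le> p x * (K * exp (a + b) ^ x)"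
      by (rule mult_left_mono[OF pt pmix_nonneg])
    then show "ennreal (p x * (if m < x then (real x)\<^sup>2 else 0))
        \<le> ennreal K * ennreal (p x * exp (a + b) ^ x)"
      using K by (simp add: ennreal_mult'[symmetric] ennreal_leI mult.left_commute)
  qed auto
  also have "\<dots> = ennreal K * (\<Sum>x. ennreal (p x * exp (a + b) ^ x))"
    by (rule ennreal_suminf_cmult)
  also have "\<dots> = ennreal K * (\<integral>\<^sup>+\<theta>. ennreal (exp (\<theta> * (exp (a + b) - 1))) \<partial>\<pi>)"
    by (subst suminf_pmix_power) auto
  finally show ?thesis by (simp add: K_def)
qed

text \<open>The bound of \<open>fstar\<close> by \<open>h\<close> without a division. It makes
  \<open>p\<close> at least halve from each point beyond \<open>2 * h\<close> to the next.\<close>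

lemma pmix_ratio:
  assumes "AE \<theta> in \<pi>. \<theta> \<le> h"
  shows "real (x + 1) * p (x + 1) \<le> h * p x"
proof -
  have "AE \<theta> in \<pi>. poi \<theta> x * \<theta> \<le> poi \<theta> x * h"
    using assms prior_nonneg by eventually_elim (simp add: poi_nonneg mult_left_mono)
  then have "(\<integral>\<theta>. poi \<theta> x * \<theta> \<partial>\<pi>) \<le> (\<integral>\<theta>. poi \<theta> x * h \<partial>\<pi>)"
    by (intro integral_mono_AE) auto
  then show ?thesis unfolding pmix_mean by (simp add: pmix_def mult.commute)
qed

end

subsection \<open>The regret bound\<close>

text \<open>\<open>score g x y\<close> is the contribution of an observation \<open>y\<close> to the coefficient of the value at \<open>x\<close>
  in the first-order condition at \<open>g\<close>.\<close>
definition score :: "(nat \<Rightarrow> real) \<Rightarrow> nat \<Rightarrow> nat \<Rightarrow> real" where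
  "score g x y = (if y = Suc x then real (Suc x) else 0) - (if y = x then g x else 0)"

text \<open>The cost of bounding twice the product of \<open>erm xs x - g x\<close> and
  \<open>Z\<close>. If the expected count \<open>u\<close> is at least 1, the arithmetic-geometric
  mean inequality is efficient; for smaller \<open>u\<close> division by \<open>u\<close> would be
  too costly, and the deviation is simply bounded by \<open>m\<close>.\<close>

definition noise :: "(nat \<Rightarrow> real) \<Rightarrow> nat \<Rightarrow> nat list \<Rightarrow> real \<Rightarrow> nat \<Rightarrow> real" where
  "noise g m xs u x =
     (let Z = \<Sum>y\<leftarrow>xs. score g x y in if 1 \<le> u then 2 * Z\<^sup>2 / u else 2 * real m * \<bar>Z\<bar>)"

text \<open>It prices everything beyond \<open>m\<close> in two roles: test points that exceed
  \<open>m\<close>, and samples containing an observation that does.\<close>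

definition tail_square :: "nat \<Rightarrow> nat \<Rightarrow> real" where
  "tail_square m x = (if m < x then (real x)\<^sup>2 else 0)"

lemma tail_square_nonneg: "0 \<le> tail_square m x"
  by (simp add: tail_square_def)

section \<open>Deterministic error bounds for a fixed sample\<close>

lemma sum_list_eq_sum_count_list:
  fixes f :: "'a \<Rightarrow> real"
  assumes "finite A" "set xs \<subseteq> A"
  shows "(\<Sum>y\<leftarrow>xs. f y) = (\<Sum>x\<in>A. real (count_list xs x) * f x)"
  using assms(2)
proof (induction xs)
  case (Cons y xs)
  have "(\<Sum>x\<in>A. real (count_list (y # xs) x) * f x)
      = (\<Sum>x\<in>A. (if y = x then f x else 0) + real (count_list xs x) * f x)"
    by (intro sum.cong) (auto simp: algebra_simps)
  with Cons assms(1) show ?case by (simp add: sum.distrib sum.delta')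
qed simp

text \<open>The sum is regrouped by the point at which \<open>d\<close> is evaluated: an observation
  \<open>y\<close> touches only \<open>y - 1\<close> and \<open>y\<close>, and \<open>y = 0\<close>
  only the latter.\<close>

lemma sum_list_scores:
  assumes "\<And>y. y \<in> set xs \<Longrightarrow> y \<le> m"
  shows "(\<Sum>y\<leftarrow>xs. real y * d (y - 1) - g y * d y) = (\<Sum>x\<le>m. d x * (\<Sum>y\<leftarrow>xs. score g x y))"
  using assms
proof (induction xs)
  case (Cons y xs)
  have y: "y \<le> m" using Cons.prems by simp
  have "(\<Sum>x\<le>m. d x * score g x y)
      = (\<Sum>x\<le>m. if y = Suc x then d x * real (Suc x) else 0) - (\<Sum>x\<le>m. if y = x then d x * g x else 0)"
    unfolding sum_subtractf[symmetric] by (intro sum.cong) (auto simp: score_def algebra_simps)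
  also have "(\<Sum>x\<le>m. if y = Suc x then d x * real (Suc x) else 0) = real y * d (y - 1)"
    using y by (cases y) (auto simp: sum.delta)
  also have "(\<Sum>x\<le>m. if y = x then d x * g x else 0) = g y * d y"
    using y by (simp add: sum.delta)
  finally show ?case using Cons by (simp add: distrib_left sum.distrib)
qed simp

text \<open>Let \<open>Q\<close> be the left-hand side. Replacing \<open>u x\<close> by twice the
  count plus the undercount and using the basic inequality bounds \<open>Q\<close> by
  \<open>2 * (\<Sum>x\<le>m. d x * Z x)\<close> plus \<open>m^2\<close> times the undercounts. The
  first of these is at most \<open>Q / 2\<close> plus the noise, and absorbing \<open>Q / 2\<close>
  on the left doubles the rest.\<close>

lemma erm_loss_on_bounded_sample:
  assumes p: "\<And>x. 0 \<le> p x" and g: "g \<in> monoF" "\<And>x. g x \<le> real m"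
    and xs: "length xs = n" "1 \<le> n" "\<And>y. y \<in> set xs \<Longrightarrow> y \<le> m"
  defines "u \<equiv> \<lambda>x. real n * p x"
  shows "(\<Sum>x\<le>m. u x * (erm xs x - g x)\<^sup>2)
    \<le> 2 * (\<Sum>x\<le>m. noise g m xs (u x) x)
      + 2 * (real m)\<^sup>2 * (\<Sum>x\<le>m. max 0 (u x - 2 * real (count_list xs x)))"
proof -
  have ne: "xs \<noteq> []" using xs by auto
  define d where "d = (\<lambda>x. erm xs x - g x)"
  define Z where "Z = (\<lambda>x. \<Sum>y\<leftarrow>xs. score g x y)"
  have "Max (set xs) \<le> m" using xs ne by simp
  then have erm: "0 \<le> erm xs x" "erm xs x \<le> real m" for x
    using monoF_D(1)[OF erm_in_monoF[OF ne]] erm_le_Max[OF ne, of x] by (auto intro: order_trans)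
  have abs: "\<bar>d x\<bar> \<le> real m" for x
    using erm[of x] g(2)[of x] monoF_D(1)[OF g(1), of x] by (auto simp: d_def abs_le_iff)
  then have sq: "(d x)\<^sup>2 \<le> (real m)\<^sup>2" for x
    by (simp add: abs_le_square_iff[symmetric])
  have noise: "noise g m xs (u x) x = (if 1 \<le> u x then 2 * (Z x)\<^sup>2 / u x else 2 * real m * \<bar>Z x\<bar>)" for x
    by (simp add: noise_def Z_def Let_def)
  have Z_le: "2 * (d x * Z x) \<le> u x * (d x)\<^sup>2 / 2 + noise g m xs (u x) x" for x
  proof (cases "1 \<le> u x")
    case True
    have "0 \<le> (u x * d x - 2 * Z x)\<^sup>2 / (2 * u x)" using True by simp
    also have "\<dots> = u x * (d x)\<^sup>2 / 2 - 2 * (d x * Z x) + 2 * (Z x)\<^sup>2 / u x"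
      using True by (simp add: field_simps power2_eq_square)
    finally show ?thesis using True by (simp add: noise)
  next
    case False
    have "d x * Z x \<le> \<bar>d x\<bar> * \<bar>Z x\<bar>" by (simp add: abs_mult[symmetric])
    also have "\<dots> \<le> real m * \<bar>Z x\<bar>" using abs by (intro mult_right_mono) auto
    finally have "2 * (d x * Z x) \<le> noise g m xs (u x) x"
      using False by (simp add: noise)
    moreover have "0 \<le> u x * (d x)\<^sup>2 / 2" using p by (simp add: u_def)
    ultimately show ?thesis by linarith
  qed
  have U: "u x * (d x)\<^sup>2 \<le> 2 * (real (count_list xs x) * (d x)\<^sup>2)
      + (real m)\<^sup>2 * max 0 (u x - 2 * real (count_list xs x))" for x
  proof -
    let ?U = "max 0 (u x - 2 * real (count_list xs x))"
    have "u x * (d x)\<^sup>2 \<le> (2 * real (count_list xs x) + ?U) * (d x)\<^sup>2"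
      by (intro mult_right_mono) auto
    also have "\<dots> = 2 * (real (count_list xs x) * (d x)\<^sup>2) + ?U * (d x)\<^sup>2"
      by (simp add: algebra_simps)
    also have "?U * (d x)\<^sup>2 \<le> ?U * (real m)\<^sup>2" using sq by (intro mult_left_mono) auto
    finally show ?thesis by (simp add: mult.commute)
  qed
  have "(\<Sum>x\<le>m. real (count_list xs x) * (d x)\<^sup>2) = (\<Sum>y\<leftarrow>xs. (d y)\<^sup>2)"
    by (intro sum_list_eq_sum_count_list[symmetric]) (auto dest: xs(3))
  also have "\<dots> \<le> (\<Sum>y\<leftarrow>xs. real y * d (y - 1) - g y * d y)"
    unfolding d_def by (rule erm_basic_inequality[OF ne g(1)])
  also have "\<dots> = (\<Sum>x\<le>m. d x * Z x)"
    unfolding Z_def by (rule sum_list_scores[OF xs(3)])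
  finally have basic: "(\<Sum>x\<le>m. real (count_list xs x) * (d x)\<^sup>2) \<le> (\<Sum>x\<le>m. d x * Z x)" .
  have "(\<Sum>x\<le>m. u x * (d x)\<^sup>2) \<le> 2 * (\<Sum>x\<le>m. real (count_list xs x) * (d x)\<^sup>2)
      + (real m)\<^sup>2 * (\<Sum>x\<le>m. max 0 (u x - 2 * real (count_list xs x)))"
    unfolding sum_distrib_left sum.distrib[symmetric] by (intro sum_mono U)
  moreover have "2 * (\<Sum>x\<le>m. d x * Z x)
      \<le> (\<Sum>x\<le>m. u x * (d x)\<^sup>2) / 2 + (\<Sum>x\<le>m. noise g m xs (u x) x)"
    unfolding sum_distrib_left sum_divide_distrib sum.distrib[symmetric] by (intro sum_mono Z_le)
  ultimately show ?thesis using basic unfolding d_def by linarith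
qed

text \<open>If no observation exceeds \<open>m\<close>, the error is at most \<open>m\<close>
  everywhere, so test points beyond \<open>m\<close> cost at most \<open>tail_square\<close>.
  Otherwise the whole error is at most the squared sample maximum, which is a single term of the
  last sum.\<close>

lemma erm_loss_bound:
  assumes p: "\<And>x. 0 \<le> p x" "p sums 1" and g: "g \<in> monoF" "\<And>x. g x \<le> real m"
    and xs: "length xs = n" "1 \<le> n"
  defines "u \<equiv> \<lambda>x. real n * p x"
  shows "(\<Sum>x. ennreal (p x * (erm xs x - g x)\<^sup>2))
    \<le> ennreal ((2 * (\<Sum>x\<le>m. noise g m xs (u x) x)
        + 2 * (real m)\<^sup>2 * (\<Sum>x\<le>m. max 0 (u x - 2 * real (count_list xs x)))) / real n)
      + (\<Sum>x. ennreal (p x * tail_square m x)) + ennreal (\<Sum>y\<leftarrow>xs. tail_square m y)"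
    (is "_ \<le> ennreal (?B / real n) + ?\<kappa> + ?\<tau>")
proof -
  have ne: "xs \<noteq> []" using xs by auto
  define M where "M = real (max m (Max (set xs)))"
  have sq: "(erm xs x - g x)\<^sup>2 \<le> M\<^sup>2" for x
  proof -
    have "\<bar>erm xs x - g x\<bar> \<le> M"
      using monoF_D(1)[OF erm_in_monoF[OF ne], of x] erm_le_Max[OF ne, of x]
        g(2)[of x] monoF_D(1)[OF g(1), of x]
      by (auto simp: M_def abs_le_iff of_nat_max max_def)
    then show ?thesis by (simp add: abs_le_square_iff[symmetric] M_def)
  qed
  show ?thesis
  proof (cases "Max (set xs) \<le> m")
    case True
    then have le: "y \<le> m" if "y \<in> set xs" for y
      using that by (meson List.finite_set Max_ge order_trans)
    have M: "M = real m" using True by (simp add: M_def max_def)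
    have "real n * (\<Sum>x\<le>m. p x * (erm xs x - g x)\<^sup>2) \<le> ?B"
      using erm_loss_on_bounded_sample[OF p(1) g xs le]
      by (simp add: sum_distrib_left u_def mult.assoc)
    then have head: "(\<Sum>x\<le>m. p x * (erm xs x - g x)\<^sup>2) \<le> ?B / real n"
      using xs by (simp add: field_simps)
    have "(\<Sum>x. ennreal (p x * (erm xs x - g x)\<^sup>2))
        \<le> (\<Sum>x. ennreal (if x \<le> m then p x * (erm xs x - g x)\<^sup>2 else 0)
            + ennreal (p x * tail_square m x))"
    proof (intro suminf_le)
      fix x
      show "ennreal (p x * (erm xs x - g x)\<^sup>2)
          \<le> ennreal (if x \<le> m then p x * (erm xs x - g x)\<^sup>2 else 0)
            + ennreal (p x * tail_square m x)"
      proof (cases "x \<le> m")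
        case False
        have "(erm xs x - g x)\<^sup>2 \<le> (real m)\<^sup>2" using sq M by simp
        also have "\<dots> \<le> (real x)\<^sup>2" using False by (intro power_mono) auto
        finally have "p x * (erm xs x - g x)\<^sup>2 \<le> p x * tail_square m x"
          using False by (intro mult_left_mono p) (simp add: tail_square_def)
        then show ?thesis using False by (simp add: ennreal_leI)
      qed simp
    qed auto
    also have "\<dots> = (\<Sum>x. ennreal (if x \<le> m then p x * (erm xs x - g x)\<^sup>2 else 0)) + ?\<kappa>"
      by (rule suminf_add[symmetric]) auto
    also have "(\<Sum>x. ennreal (if x \<le> m then p x * (erm xs x - g x)\<^sup>2 else 0))
        = (\<Sum>x\<le>m. ennreal (p x * (erm xs x - g x)\<^sup>2))"
      by (subst suminf_finite[of "{..m}"]) auto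
    also have "\<dots> = ennreal (\<Sum>x\<le>m. p x * (erm xs x - g x)\<^sup>2)"
      by (intro sum_ennreal) (simp add: p(1))
    also have "\<dots> \<le> ennreal (?B / real n)" by (rule ennreal_leI[OF head])
    finally show ?thesis by (meson add_right_mono add_increasing2 order_trans zero_le)
  next
    case False
    then have M: "M = real (Max (set xs))" by (simp add: M_def max_def)
    have "(\<Sum>x. ennreal (p x * (erm xs x - g x)\<^sup>2)) \<le> (\<Sum>x. ennreal (p x * M\<^sup>2))"
      using sq by (intro suminf_le ennreal_leI mult_left_mono p(1)) auto
    also have "\<dots> = ennreal (M\<^sup>2)"
      using sums_mult2[OF p(2), of "M\<^sup>2"] by (intro suminf_ennreal_sums) (simp_all add: p(1))
    also have "M\<^sup>2 = tail_square m (Max (set xs))" using False M by (simp add: tail_square_def)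
    also have "ennreal \<dots> \<le> ?\<tau>"
      using ne by (intro ennreal_leI member_le_sum_list) (auto simp: tail_square_nonneg)
    finally show ?thesis by (simp add: add_increasing)
  qed
qed

section \<open>Expected noise relative to the truncated Bayes estimator, and the general regret
  bound\<close>

context prior
begin

lemmas pmix_density = pmix_nonneg pmix_sums

definition trunc :: "real \<Rightarrow> nat \<Rightarrow> real" where
  "trunc T x = min (fstar x) T"

definition excess :: "real \<Rightarrow> nat \<Rightarrow> real" where
  "excess T x = max 0 (fstar x - T)"

lemma fstar_eq: "fstar x = trunc T x + excess T x"
  by (simp add: trunc_def excess_def)

lemma excess_nonneg: "0 \<le> excess T x"
  by (simp add: excess_def)

lemma trunc_monoF:
  assumes "0 \<le> T"
  shows "trunc T \<in> monoF"
proof -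
  have "fstar \<in> monoF" using fstar_mono fstar_nonneg by (simp add: monoF_def)
  from monoF_min[OF this assms] show ?thesis by (simp add: trunc_def[abs_def])
qed

text \<open>The score lives on the two points \<open>x\<close> and \<open>Suc x\<close>, so squares
  and absolute values have no cross terms. The mass at \<open>Suc x\<close> is rewritten by
  \<open>pmix_fstar\<close>, which makes all three moments multiples of \<open>p x\<close>.\<close>

lemma score_sums:
  shows "(\<lambda>y. p y * score g x y) sums (p x * (fstar x - g x))"
    and "(\<lambda>y. p y * (score g x y)\<^sup>2) sums (p x * (real (Suc x) * fstar x + (g x)\<^sup>2))"
    and "0 \<le> g x \<Longrightarrow> (\<lambda>y. p y * \<bar>score g x y\<bar>) sums (p x * (fstar x + g x))"
proof -
  have two: "(\<lambda>y. (if y = Suc x then a else 0) + (if y = x then b else 0)) sums (a + b)" for a b :: real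
    using sums_add[OF sums_single[of "Suc x" "\<lambda>_. a"] sums_single[of x "\<lambda>_. b"]] .
  have m: "real (Suc x) * p (Suc x) = p x * fstar x" using pmix_fstar[of x] by simp
  have "(\<lambda>y. p y * score g x y)
      = (\<lambda>y. (if y = Suc x then real (Suc x) * p (Suc x) else 0) + (if y = x then - (p x * g x) else 0))"
    by (auto simp: score_def)
  with two[of "real (Suc x) * p (Suc x)" "- (p x * g x)"]
  show "(\<lambda>y. p y * score g x y) sums (p x * (fstar x - g x))"
    unfolding m by (simp add: algebra_simps)
  have "(\<lambda>y. p y * (score g x y)\<^sup>2)
      = (\<lambda>y. (if y = Suc x then real (Suc x) * (real (Suc x) * p (Suc x)) else 0)
          + (if y = x then p x * (g x)\<^sup>2 else 0))"
    by (auto simp: score_def power2_eq_square)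
  with two[of "real (Suc x) * (real (Suc x) * p (Suc x))" "p x * (g x)\<^sup>2"]
  show "(\<lambda>y. p y * (score g x y)\<^sup>2) sums (p x * (real (Suc x) * fstar x + (g x)\<^sup>2))"
    unfolding m by (simp add: algebra_simps)
  assume "0 \<le> g x"
  then have "(\<lambda>y. p y * \<bar>score g x y\<bar>)
      = (\<lambda>y. (if y = Suc x then real (Suc x) * p (Suc x) else 0) + (if y = x then p x * g x else 0))"
    by (auto simp: score_def)
  with two[of "real (Suc x) * p (Suc x)" "p x * g x"]
  show "(\<lambda>y. p y * \<bar>score g x y\<bar>) sums (p x * (fstar x + g x))"
    unfolding m by (simp add: algebra_simps)
qed

text \<open>For \<open>u\<close> at least 1, the score sum has mean \<open>u * a\<close> and
  variance at most \<open>u * (Suc x * fstar x + (g x)^2)\<close>, and division by \<open>u\<close>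
  leaves a bound free of \<open>u\<close> apart from the excess. For \<open>u\<close> below 1 the
  first absolute moment suffices.\<close>

lemma iid_exp_noise:
  fixes n m x :: nat and T :: real
  assumes T: "0 \<le> T" "T \<le> real m" and x: "x \<le> m"
  defines "u \<equiv> real n * p x" and "a \<equiv> excess T x" and "g \<equiv> trunc T"
  shows "iid_exp p n (\<lambda>xs. ennreal (noise g m xs u x))
    \<le> ennreal (4 * (real m + 1) * T + 2 * (real m + 1) * (u * a) + 2 * (u * a\<^sup>2))"
proof -
  have u: "0 \<le> u" by (simp add: u_def pmix_nonneg)
  have a: "0 \<le> a" by (simp add: a_def excess_nonneg)
  have g: "0 \<le> g x" "g x \<le> T"
    using fstar_nonneg T by (auto simp: g_def trunc_def)
  have f: "fstar x = g x + a" by (simp add: g_def a_def fstar_eq[of x T])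
  have ua: "0 \<le> u * a" using u a by simp
  show ?thesis
  proof (cases "1 \<le> u")
    case True
    have "iid_exp p n (\<lambda>xs. ennreal (noise g m xs u x))
        = iid_exp p n (\<lambda>xs. ennreal (2 / u) * ennreal ((0 + (\<Sum>y\<leftarrow>xs. score g x y))\<^sup>2))"
      using True by (intro iid_exp_cong) (simp add: noise_def ennreal_mult'[symmetric])
    also have "\<dots> \<le> ennreal (2 / u) * ennreal ((0 + real n * (p x * (fstar x - g x)))\<^sup>2
          + real n * (p x * (real (Suc x) * fstar x + (g x)\<^sup>2)))"
      unfolding iid_exp_cmult
      by (intro mult_left_mono iid_exp_square_sum_list[OF pmix_density] score_sums) simp
    also have "\<dots> = ennreal (2 / u * ((u * a)\<^sup>2 + u * (real (Suc x) * (g x + a) + (g x)\<^sup>2)))"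
      using True by (simp add: ennreal_mult'[symmetric] u_def f mult.assoc del: of_nat_Suc)
    also have "\<dots> \<le> ennreal (4 * (real m + 1) * T + 2 * (real m + 1) * (u * a) + 2 * (u * a\<^sup>2))"
    proof (rule ennreal_leI)
      have "2 / u * ((u * a)\<^sup>2 + u * (real (Suc x) * (g x + a) + (g x)\<^sup>2))
          = 2 * (u * a\<^sup>2) + 2 * (real (Suc x) * (g x + a)) + 2 * (g x * g x)"
        using True by (simp add: field_simps power2_eq_square)
      moreover have "real (Suc x) * (g x + a) \<le> (real m + 1) * (T + u * a)"
      proof (intro mult_mono add_mono g)
        \<comment> \<open>The excess is multiplied by \<open>u\<close> because only weighted
          excesses can be summed over \<open>x\<close>.\<close>
        show "a \<le> u * a" using mult_right_mono[OF True a] by simp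
      qed (use x g a in auto)
      moreover have "g x * g x \<le> (real m + 1) * T" using g T by (intro mult_mono) auto
      ultimately show "2 / u * ((u * a)\<^sup>2 + u * (real (Suc x) * (g x + a) + (g x)\<^sup>2))
          \<le> 4 * (real m + 1) * T + 2 * (real m + 1) * (u * a) + 2 * (u * a\<^sup>2)"
        by (simp add: algebra_simps)
    qed
    finally show ?thesis .
  next
    case False
    have "iid_exp p n (\<lambda>xs. ennreal (noise g m xs u x))
        \<le> iid_exp p n (\<lambda>xs. ennreal (2 * real m) * ennreal (\<Sum>y\<leftarrow>xs. \<bar>score g x y\<bar>))"
    proof (intro iid_exp_mono)
      fix xs :: "nat list"
      have "2 * real m * \<bar>\<Sum>y\<leftarrow>xs. score g x y\<bar> \<le> 2 * real m * (\<Sum>y\<leftarrow>xs. \<bar>score g x y\<bar>)"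
        using sum_list_abs[of "map (score g x) xs"] by (intro mult_left_mono) (auto simp: comp_def)
      then show "ennreal (noise g m xs u x) \<le> ennreal (2 * real m) * ennreal (\<Sum>y\<leftarrow>xs. \<bar>score g x y\<bar>)"
        using False by (simp add: noise_def ennreal_mult'[symmetric] ennreal_leI)
    qed
    also have "\<dots> = ennreal (2 * real m) * (of_nat n * (\<Sum>y. ennreal (p y * \<bar>score g x y\<bar>)))"
      unfolding iid_exp_cmult by (subst iid_exp_sum_list[OF pmix_density]) auto
    also have "(\<Sum>y. ennreal (p y * \<bar>score g x y\<bar>)) = ennreal (p x * (fstar x + g x))"
      by (intro suminf_ennreal_sums score_sums g) (simp add: pmix_nonneg)
    also have "ennreal (2 * real m) * (of_nat n * \<dots>) = ennreal (2 * real m * (u * (2 * g x + a)))"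
      by (simp add: ennreal_of_nat_eq_real_of_nat ennreal_mult'[symmetric] u_def f mult.assoc)
    also have "\<dots> \<le> ennreal (4 * (real m + 1) * T + 2 * (real m + 1) * (u * a) + 2 * (u * a\<^sup>2))"
    proof (rule ennreal_leI)
      have "u * g x \<le> 1 * T" using False u g by (intro mult_mono) auto
      then have "u * (2 * g x + a) \<le> 2 * T + u * a" by (simp add: algebra_simps)
      then have "2 * real m * (u * (2 * g x + a)) \<le> 2 * (real m + 1) * (2 * T + u * a)"
        using u g a T by (intro mult_mono) auto
      moreover have "0 \<le> u * a\<^sup>2" using u by simp
      ultimately show "2 * real m * (u * (2 * g x + a))
          \<le> 4 * (real m + 1) * T + 2 * (real m + 1) * (u * a) + 2 * (u * a\<^sup>2)"
        by (simp add: algebra_simps)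
    qed
    finally show ?thesis .
  qed
qed

text \<open>The linear excess is reduced to the quadratic one by \<open>r \<le> 1 + r^2\<close> with
  \<open>r = n * a\<close>, averaged under \<open>p\<close>. The resulting factor \<open>n^2\<close>
  is why the excess is assumed to be of order \<open>D / n^2\<close>.\<close>

lemma sum_iid_exp_noise:
  fixes n m :: nat and T D :: real
  assumes n: "1 \<le> n" and T: "0 \<le> T" "T \<le> real m" and D: "0 \<le> D"
    and excess: "(\<integral>\<^sup>+\<theta>. ennreal ((max 0 (\<theta> - T))\<^sup>2) \<partial>\<pi>) \<le> ennreal (D / (real n)\<^sup>2)"
  shows "(\<Sum>x\<le>m. iid_exp p n (\<lambda>xs. ennreal (noise (trunc T) m xs (real n * p x) x)))
    \<le> ennreal (4 * (real m + 1)\<^sup>2 * T + 2 * (real m + 1) * (1 + D) + 2 * D)"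
proof -
  let ?a = "excess T" and ?u = "\<lambda>x. real n * p x"
  have "ennreal (\<Sum>x\<le>m. p x * (?a x)\<^sup>2) = (\<Sum>x\<le>m. ennreal (p x * (?a x)\<^sup>2))"
    by (intro sum_ennreal[symmetric]) (simp add: pmix_nonneg)
  also have "\<dots> \<le> (\<Sum>x. ennreal (p x * (?a x)\<^sup>2))" by (intro sum_le_suminf) auto
  also have "\<dots> \<le> ennreal (D / (real n)\<^sup>2)"
    using suminf_excess_fstar[of T] excess unfolding excess_def by (rule order_trans)
  finally have "(\<Sum>x\<le>m. p x * (?a x)\<^sup>2) \<le> D / (real n)\<^sup>2" using D by (simp add: ennreal_le_iff)
  then have sq: "(real n)\<^sup>2 * (\<Sum>x\<le>m. p x * (?a x)\<^sup>2) \<le> D" using n by (simp add: field_simps)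
  have "real n * (\<Sum>x\<le>m. p x * (?a x)\<^sup>2) \<le> (real n)\<^sup>2 * (\<Sum>x\<le>m. p x * (?a x)\<^sup>2)"
    using n by (intro mult_right_mono sum_nonneg) (auto simp: pmix_nonneg power2_eq_square)
  with sq have uaa: "(\<Sum>x\<le>m. ?u x * (?a x)\<^sup>2) \<le> D"
    by (simp add: sum_distrib_left mult.assoc)
  have "(\<Sum>x\<le>m. ?u x * ?a x) \<le> (\<Sum>x\<le>m. p x + (real n)\<^sup>2 * (p x * (?a x)\<^sup>2))"
  proof (intro sum_mono)
    fix x
    have "real n * ?a x \<le> 1 + (real n * ?a x)\<^sup>2"
      using zero_le_power2[of "real n * ?a x - 1 / 2"]
      by (simp add: power2_eq_square algebra_simps)
    then have "p x * (real n * ?a x) \<le> p x * (1 + (real n * ?a x)\<^sup>2)"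
      by (intro mult_left_mono pmix_nonneg)
    then show "?u x * ?a x \<le> p x + (real n)\<^sup>2 * (p x * (?a x)\<^sup>2)"
      by (simp add: power2_eq_square algebra_simps)
  qed
  also have "\<dots> = (\<Sum>x\<le>m. p x) + (real n)\<^sup>2 * (\<Sum>x\<le>m. p x * (?a x)\<^sup>2)"
    by (simp add: sum.distrib sum_distrib_left)
  also have "(\<Sum>x\<le>m. p x) \<le> 1"
    using sum_le_suminf[OF sums_summable[OF pmix_sums], of "{..m}"] pmix_nonneg
      sums_unique[OF pmix_sums] by auto
  finally have ua: "(\<Sum>x\<le>m. ?u x * ?a x) \<le> 1 + D" using sq by simp
  have "(\<Sum>x\<le>m. iid_exp p n (\<lambda>xs. ennreal (noise (trunc T) m xs (?u x) x)))
      \<le> (\<Sum>x\<le>m. ennreal (4 * (real m + 1) * T + 2 * (real m + 1) * (?u x * ?a x) + 2 * (?u x * (?a x)\<^sup>2)))"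
    by (intro sum_mono iid_exp_noise T) auto
  also have "\<dots> = ennreal (\<Sum>x\<le>m. 4 * (real m + 1) * T + 2 * (real m + 1) * (?u x * ?a x) + 2 * (?u x * (?a x)\<^sup>2))"
    using T by (intro sum_ennreal add_nonneg_nonneg mult_nonneg_nonneg)
      (auto simp: pmix_nonneg excess_nonneg)
  also have "\<dots> = ennreal ((real m + 1) * (4 * (real m + 1) * T)
      + 2 * (real m + 1) * (\<Sum>x\<le>m. ?u x * ?a x) + 2 * (\<Sum>x\<le>m. ?u x * (?a x)\<^sup>2))"
    by (simp add: sum.distrib sum_distrib_left add.commute)
  also have "\<dots> \<le> ennreal ((real m + 1) * (4 * (real m + 1) * T)
      + 2 * (real m + 1) * (1 + D) + 2 * D)"
    using ua uaa by (intro ennreal_leI add_mono mult_left_mono) auto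
  finally show ?thesis by (simp add: power2_eq_square mult_ac)
qed

text \<open>The interface for both classes of priors: \<open>A\<close> controls the undercounts,
  \<open>D\<close> the truncation at \<open>T\<close>, and \<open>K\<close> the tail beyond
  \<open>m\<close>. The tail is counted once for the test point and \<open>n\<close> times for the
  sample, hence its scale \<open>K / n^2\<close>.\<close>

lemma regret_bound:
  fixes n m :: nat and T A D K :: real
  assumes n: "1 \<le> n" and T: "0 \<le> T" "T \<le> real m" and nonneg: "0 \<le> A" "0 \<le> D" "0 \<le> K"
    and undercount: "(\<Sum>x\<le>m. real n * p x / ((1 + real n * p x) * (2 + real n * p x))) \<le> A"
    and excess: "(\<integral>\<^sup>+\<theta>. ennreal ((max 0 (\<theta> - T))\<^sup>2) \<partial>\<pi>) \<le> ennreal (D / (real n)\<^sup>2)"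
    and tail: "(\<Sum>x. ennreal (p x * tail_square m x)) \<le> ennreal (K / (real n)\<^sup>2)"
  shows "regret_le \<pi> n ((16 * (real m + 1)\<^sup>2 * T + 8 * (real m + 1) * (1 + D) + 10 * D
      + 2400 * (real m)\<^sup>2 * A + 4 * K) / real n)"
proof -
  define g where "g = trunc T"
  define u where "u = (\<lambda>x. real n * p x)"
  define V where "V = 4 * (real m + 1)\<^sup>2 * T + 2 * (real m + 1) * (1 + D) + 2 * D"
  let ?N = "\<lambda>x xs. noise g m xs (u x) x"
  let ?U = "\<lambda>x xs. max 0 (u x - 2 * real (count_list xs x))"
  let ?\<kappa> = "\<Sum>x. ennreal (p x * tail_square m x)"
  have g: "g \<in> monoF" "\<And>x. g x \<le> real m"
    using trunc_monoF[OF T(1)] T(2) by (auto simp: g_def trunc_def min_le_iff_disj)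
  have u0: "0 \<le> u x" for x by (simp add: u_def pmix_nonneg)
  have N0: "0 \<le> ?N x xs" for x xs using u0[of x] by (simp add: noise_def Let_def)
  have V0: "0 \<le> V" using T nonneg by (simp add: V_def)
  have split: "(\<Sum>x. ennreal (p x * (f x - fstar x)\<^sup>2))
      \<le> 2 * (\<Sum>x. ennreal (p x * (f x - g x)\<^sup>2)) + 2 * ennreal (D / (real n)\<^sup>2)" for f
  proof -
    have "(\<Sum>x. ennreal (p x * (f x - fstar x)\<^sup>2))
        \<le> (\<Sum>x. 2 * ennreal (p x * (f x - g x)\<^sup>2) + 2 * ennreal (p x * (excess T x)\<^sup>2))"
    proof (intro suminf_le)
      fix x
      have "(f x - fstar x)\<^sup>2 \<le> 2 * (f x - g x)\<^sup>2 + 2 * (excess T x)\<^sup>2"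
        using zero_le_power2[of "f x - g x + excess T x"] unfolding fstar_eq[of x T] g_def
        by (simp add: power2_eq_square algebra_simps)
      then have "p x * (f x - fstar x)\<^sup>2 \<le> p x * (2 * (f x - g x)\<^sup>2 + 2 * (excess T x)\<^sup>2)"
        by (intro mult_left_mono pmix_nonneg)
      then have "ennreal (p x * (f x - fstar x)\<^sup>2)
          \<le> ennreal (2 * (p x * (f x - g x)\<^sup>2) + 2 * (p x * (excess T x)\<^sup>2))"
        by (intro ennreal_leI) (simp add: algebra_simps)
      then show "ennreal (p x * (f x - fstar x)\<^sup>2)
          \<le> 2 * ennreal (p x * (f x - g x)\<^sup>2) + 2 * ennreal (p x * (excess T x)\<^sup>2)"
        by (simp add: ennreal_plus ennreal_mult' pmix_nonneg)
    qed auto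
    also have "\<dots> = 2 * (\<Sum>x. ennreal (p x * (f x - g x)\<^sup>2)) + 2 * (\<Sum>x. ennreal (p x * (excess T x)\<^sup>2))"
      by (subst suminf_add[symmetric]) (auto simp: ennreal_suminf_cmult)
    also have "(\<Sum>x. ennreal (p x * (excess T x)\<^sup>2)) \<le> ennreal (D / (real n)\<^sup>2)"
      using suminf_excess_fstar[of T] excess unfolding excess_def by (rule order_trans)
    finally show ?thesis by (simp add: add_left_mono mult_left_mono)
  qed
  have noise: "(\<Sum>x\<le>m. iid_exp p n (\<lambda>xs. ennreal (?N x xs))) \<le> ennreal V"
    unfolding V_def g_def u_def by (rule sum_iid_exp_noise[OF n T nonneg(2) excess])
  have under: "(\<Sum>x\<le>m. iid_exp p n (\<lambda>xs. ennreal (?U x xs))) \<le> ennreal (600 * A)"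
  proof -
    have "(\<Sum>x\<le>m. iid_exp p n (\<lambda>xs. ennreal (?U x xs)))
        \<le> (\<Sum>x\<le>m. ennreal (600 * u x / ((1 + u x) * (2 + u x))))"
      unfolding u_def by (intro sum_mono iid_exp_undercount[OF pmix_density])
    also have "\<dots> = ennreal (600 * (\<Sum>x\<le>m. u x / ((1 + u x) * (2 + u x))))"
      using u0 by (subst sum_ennreal) (auto simp: sum_distrib_left)
    also have "\<dots> \<le> ennreal (600 * A)"
      using undercount by (intro ennreal_leI) (simp add: u_def)
    finally show ?thesis .
  qed
  have head: "iid_exp p n (\<lambda>xs. ennreal ((2 * (\<Sum>x\<le>m. ?N x xs)
        + 2 * (real m)\<^sup>2 * (\<Sum>x\<le>m. ?U x xs)) / real n))
      \<le> ennreal ((2 * V + 1200 * (real m)\<^sup>2 * A) / real n)"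
  proof -
    have "ennreal ((2 * (\<Sum>x\<le>m. ?N x xs) + 2 * (real m)\<^sup>2 * (\<Sum>x\<le>m. ?U x xs)) / real n)
        = ennreal (2 / real n) * (\<Sum>x\<le>m. ennreal (?N x xs))
          + ennreal (2 * (real m)\<^sup>2 / real n) * (\<Sum>x\<le>m. ennreal (?U x xs))" for xs
    proof -
      have "ennreal (2 / real n) * (\<Sum>x\<le>m. ennreal (?N x xs))
          + ennreal (2 * (real m)\<^sup>2 / real n) * (\<Sum>x\<le>m. ennreal (?U x xs))
          = ennreal (2 / real n * (\<Sum>x\<le>m. ?N x xs) + 2 * (real m)\<^sup>2 / real n * (\<Sum>x\<le>m. ?U x xs))"
        using N0 by (subst (1 2) sum_ennreal)
          (simp_all add: ennreal_mult'[symmetric] ennreal_plus[symmetric] sum_nonneg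
            del: ennreal_plus ennreal_max_0 ennreal_max_0')
      then show ?thesis by (simp add: add_divide_distrib)
    qed
    then have "iid_exp p n (\<lambda>xs. ennreal ((2 * (\<Sum>x\<le>m. ?N x xs)
          + 2 * (real m)\<^sup>2 * (\<Sum>x\<le>m. ?U x xs)) / real n))
        = ennreal (2 / real n) * (\<Sum>x\<le>m. iid_exp p n (\<lambda>xs. ennreal (?N x xs)))
          + ennreal (2 * (real m)\<^sup>2 / real n) * (\<Sum>x\<le>m. iid_exp p n (\<lambda>xs. ennreal (?U x xs)))"
      by (simp only: iid_exp_add iid_exp_cmult iid_exp_sum)
    also have "\<dots> \<le> ennreal (2 / real n) * ennreal V + ennreal (2 * (real m)\<^sup>2 / real n) * ennreal (600 * A)"
      by (intro add_mono mult_left_mono noise under) auto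
    also have "\<dots> = ennreal (2 / real n * V + 2 * (real m)\<^sup>2 / real n * (600 * A))"
      using V0 nonneg by (simp add: ennreal_mult'[symmetric] ennreal_plus[symmetric] del: ennreal_plus)
    finally show ?thesis by (simp add: add_divide_distrib mult_ac)
  qed
  have "erm_risk \<pi> n = iid_exp p n (\<lambda>xs. test_risk \<pi> (erm xs))"
    by (simp add: erm_risk_def iid_exp_def)
  also have "\<dots> \<le> iid_exp p n (\<lambda>xs. test_risk \<pi> fstar
      + (2 * (ennreal ((2 * (\<Sum>x\<le>m. ?N x xs) + 2 * (real m)\<^sup>2 * (\<Sum>x\<le>m. ?U x xs)) / real n)
          + ?\<kappa> + ennreal (\<Sum>y\<leftarrow>xs. tail_square m y)) + 2 * ennreal (D / (real n)\<^sup>2)))"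
  proof (rule iid_exp_mono)
    fix xs :: "nat list" assume len: "length xs = n"
    show "test_risk \<pi> (erm xs) \<le> test_risk \<pi> fstar
      + (2 * (ennreal ((2 * (\<Sum>x\<le>m. ?N x xs) + 2 * (real m)\<^sup>2 * (\<Sum>x\<le>m. ?U x xs)) / real n)
          + ?\<kappa> + ennreal (\<Sum>y\<leftarrow>xs. tail_square m y)) + 2 * ennreal (D / (real n)\<^sup>2))"
      unfolding test_risk_decomposition[of "erm xs"] u_def
      by (intro add_left_mono order_trans[OF split] add_right_mono mult_left_mono
          erm_loss_bound[OF pmix_density g len n]) auto
  qed
  also have "\<dots> = test_risk \<pi> fstar
      + (2 * (iid_exp p n (\<lambda>xs. ennreal ((2 * (\<Sum>x\<le>m. ?N x xs) + 2 * (real m)\<^sup>2 * (\<Sum>x\<le>m. ?U x xs)) / real n))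
          + ?\<kappa> + of_nat n * ?\<kappa>) + 2 * ennreal (D / (real n)\<^sup>2))"
    by (simp only: iid_exp_add iid_exp_cmult iid_exp_const[OF pmix_density]
        iid_exp_sum_list[OF pmix_density tail_square_nonneg])
  also have "\<dots> \<le> test_risk \<pi> fstar
      + (2 * (ennreal ((2 * V + 1200 * (real m)\<^sup>2 * A) / real n)
          + ennreal (K / (real n)\<^sup>2) + of_nat n * ennreal (K / (real n)\<^sup>2)) + 2 * ennreal (D / (real n)\<^sup>2))"
    by (intro add_mono mult_left_mono order_refl head tail) auto
  also have "2 * (ennreal ((2 * V + 1200 * (real m)\<^sup>2 * A) / real n)
          + ennreal (K / (real n)\<^sup>2) + of_nat n * ennreal (K / (real n)\<^sup>2)) + 2 * ennreal (D / (real n)\<^sup>2)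
      = ennreal (2 * ((2 * V + 1200 * (real m)\<^sup>2 * A) / real n + K / (real n)\<^sup>2 + real n * (K / (real n)\<^sup>2))
          + 2 * (D / (real n)\<^sup>2))"
  proof -
    have "2 * (ennreal a + ennreal b + of_nat n * ennreal b) + 2 * ennreal d
        = ennreal (2 * (a + b + real n * b) + 2 * d)"
      if "0 \<le> a" "0 \<le> b" "0 \<le> d" for a b d
      using that by (simp add: ennreal_plus ennreal_mult' ennreal_of_nat_eq_real_of_nat)
    then show ?thesis using V0 nonneg by simp
  qed
  also have "test_risk \<pi> fstar + \<dots> \<le> test_risk \<pi> fstar
      + ennreal ((16 * (real m + 1)\<^sup>2 * T + 8 * (real m + 1) * (1 + D) + 10 * D
      + 2400 * (real m)\<^sup>2 * A + 4 * K) / real n)"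
  proof (intro add_left_mono ennreal_leI)
    have le: "c / (real n)\<^sup>2 \<le> c / real n" if "0 \<le> c" for c :: real
      using n that by (intro divide_left_mono) (auto simp: power2_eq_square)
    have "real n * (K / (real n)\<^sup>2) = K / real n" using n by (simp add: power2_eq_square)
    then have "2 * ((2 * V + 1200 * (real m)\<^sup>2 * A) / real n + K / (real n)\<^sup>2 + real n * (K / (real n)\<^sup>2))
          + 2 * (D / (real n)\<^sup>2)
        \<le> 2 * ((2 * V + 1200 * (real m)\<^sup>2 * A) / real n + K / real n + K / real n) + 2 * (D / real n)"
      using le[of K] le[of D] nonneg by simp
    also have "\<dots> = (4 * V + 2400 * (real m)\<^sup>2 * A + 4 * K + 2 * D) / real n"
      by (simp add: add_divide_distrib)
    finally show "2 * ((2 * V + 1200 * (real m)\<^sup>2 * A) / real n + K / (real n)\<^sup>2 + real n * (K / (real n)\<^sup>2))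
          + 2 * (D / (real n)\<^sup>2)
        \<le> (16 * (real m + 1)\<^sup>2 * T + 8 * (real m + 1) * (1 + D) + 10 * D
      + 2400 * (real m)\<^sup>2 * A + 4 * K) / real n"
      by (simp add: V_def algebra_simps)
  qed
  finally show ?thesis unfolding regret_le_def .
qed

end

subsection \<open>Bounded and subexponential priors\<close>

lemma undercount_le_1:
  fixes u :: real
  assumes "0 \<le> u"
  shows "u / ((1 + u) * (2 + u)) \<le> 1"
proof -
  have "u \<le> (1 + u) * (2 + u)" using assms by (simp add: algebra_simps)
  moreover have "0 < (1 + u) * (2 + u)" using assms by (intro mult_pos_pos) auto
  ultimately show ?thesis by (simp add: pos_divide_le_eq)
qed

lemma regret_le_mono:
  assumes "regret_le \<pi> n B" "B \<le> B'"
  shows "regret_le \<pi> n B'"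
  using assms unfolding regret_le_def by (meson add_left_mono ennreal_leI order_trans)

text \<open>This makes \<open>ln (ln (real n))\<close> positive from \<open>n = 3\<close> on, so
  that dividing by it is harmless.\<close>

lemma ln_gt_1:
  assumes "3 \<le> (n::nat)"
  shows "1 < ln (real n)"
proof -
  have "1 < ln (272/100 :: real)" by (rule ln_272_gt_1)
  also have "\<dots> \<le> ln (real n)" using assms by simp
  finally show ?thesis .
qed

lemma exp_minus_2_ln:
  fixes x :: real
  assumes "0 < x"
  shows "exp (- (2 * ln x)) = 1 / x\<^sup>2"
  using assms by (simp only: exp_minus exp_double exp_ln inverse_eq_divide)

lemma nat_ceiling_bounds:
  fixes z :: real
  assumes "0 \<le> z"
  shows "z \<le> real (nat \<lceil>z\<rceil>)" "real (nat \<lceil>z\<rceil>) \<le> z + 1"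
  using assms by linarith+

context prior
begin

text \<open>Truncating at \<open>T = h\<close> leaves no excess, so \<open>D = 0\<close>. With
  \<open>m\<close> of order \<open>H * l\<close> and \<open>A = 4 * H\<close>, the terms
  \<open>m^2 * T\<close> and \<open>m^2 * A\<close> both have the order
  \<open>H^3 * l^2\<close>.\<close>

lemma regret_bound_bounded_support:
  assumes n: "3 \<le> n" and h: "0 < h" and supp: "AE \<theta> in \<pi>. \<theta> \<le> h"
  shows "regret_le \<pi> n (10 ^ 7 * (max 1 h) ^ 3 / real n * (ln (real n) / ln (ln (real n)))\<^sup>2)"
proof -
  define H where "H = max 1 h"
  define L where "L = ln (real n)"
  define l where "l = L / ln L"
  define m where "m = nat \<lceil>10 * H * l\<rceil>"
  define u where "u = (\<lambda>x. real n * p x)"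
  have H: "1 \<le> H" "h \<le> H" by (auto simp: H_def)
  have L: "1 < L" unfolding L_def by (rule ln_gt_1[OF n])
  then have lnL: "0 < ln L" by simp
  have "ln L \<le> L" using ln_le_minus_one[of L] L by linarith
  then have l: "1 \<le> l" using lnL by (simp add: l_def)
  have Hl: "H \<le> H * l" "1 \<le> H * l"
    using H l mult_left_mono[OF l, of H] by linarith+
  have m: "10 * H * l \<le> real m" "real m + 1 \<le> 12 * (H * l)"
    using nat_ceiling_bounds[of "10 * H * l"] Hl unfolding m_def by linarith+
  have u0: "0 \<le> u x" for x by (simp add: u_def pmix_nonneg)
  have under: "(\<Sum>x\<le>m. u x / ((1 + u x) * (2 + u x))) \<le> 4 * H"
  proof -
    let ?f = "\<lambda>x. u x / ((1 + u x) * (2 + u x))"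
    \<comment> \<open>Below \<open>k\<close> each term is at most 1; from \<open>k\<close> on the
      terms telescope to at most 1. The total is at most \<open>2 * h + 2\<close>.\<close>
    define k where "k = nat \<lceil>2 * h\<rceil>"
    have k: "2 * h \<le> real k" "real k \<le> 2 * h + 1"
      using nat_ceiling_bounds[of "2 * h"] h by (auto simp: k_def)
    have half: "u (Suc x) \<le> u x / 2" if "k \<le> x" for x
    proof -
      have "2 * h * u (Suc x) \<le> real (x + 1) * u (Suc x)"
        using that k u0 by (intro mult_right_mono) auto
      also have "\<dots> \<le> h * u x"
        using mult_left_mono[OF pmix_ratio[OF supp, of x], of "real n"]
        by (simp add: u_def algebra_simps)
      finally show ?thesis using h by simp
    qed
    have f0: "0 \<le> ?f x" for x using u0 by simp
    have "(\<Sum>x\<le>m. ?f x) \<le> (\<Sum>x\<in>{..<k} \<union> {k..<k + Suc m}. ?f x)"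
      using f0 by (intro sum_mono2) auto
    also have "\<dots> = (\<Sum>x<k. ?f x) + (\<Sum>x\<in>{k..<k + Suc m}. ?f x)"
      by (rule sum.union_disjoint) auto
    also have "(\<Sum>x<k. ?f x) \<le> real k"
      using sum_bounded_above[of "{..<k}" ?f 1] undercount_le_1[OF u0] by simp
    also have "(\<Sum>x\<in>{k..<k + Suc m}. ?f x) \<le> 1 - u (k + Suc m) / (1 + u (k + Suc m))"
      using u0 half by (rule sum_geometric_decay_bound)
    also have "\<dots> \<le> 1" using u0[of "k + Suc m"] by simp
    finally show ?thesis using k H by linarith
  qed
  have excess: "(\<integral>\<^sup>+\<theta>. ennreal ((max 0 (\<theta> - h))\<^sup>2) \<partial>\<pi>) \<le> ennreal (0 / (real n)\<^sup>2)"
  proof -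
    have "(\<integral>\<^sup>+\<theta>. ennreal ((max 0 (\<theta> - h))\<^sup>2) \<partial>\<pi>) = (\<integral>\<^sup>+\<theta>. 0 \<partial>\<pi>)"
      by (rule nn_integral_cong_AE, use supp in eventually_elim) simp
    then show ?thesis by simp
  qed
  have tail: "(\<Sum>x. ennreal (p x * tail_square m x)) \<le> ennreal (2 / (real n)\<^sup>2)"
  proof -
    \<comment> \<open>With this rate the exponential moment costs at most \<open>3 * H * L\<close>
      in the exponent, while \<open>b * m\<close> gains at least \<open>5 * H * L\<close>, because
      \<open>l\<close> carries the factor \<open>1 / ln L\<close>. The difference of
      \<open>2 * L\<close> gives \<open>1 / n^2\<close>.\<close>
    define b where "b = ln L / 2"
    have b: "0 \<le> b" using lnL by (simp add: b_def)
    have "exp (1 + b) \<le> 3 * L"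
    proof -
      have "exp b \<le> exp (ln L)" using lnL by (simp add: b_def)
      then have "exp b \<le> L" using L by simp
      then have "exp 1 * exp b \<le> 3 * L" using exp_le by (intro mult_mono) auto
      then show ?thesis by (simp add: exp_add)
    qed
    then have eb: "exp (1 + b) - 1 \<le> 3 * L" "0 \<le> exp (1 + b) - 1" using b by auto
    have "(\<integral>\<^sup>+\<theta>. ennreal (exp (\<theta> * (exp (1 + b) - 1))) \<partial>\<pi>) \<le> (\<integral>\<^sup>+\<theta>. ennreal (exp (H * (3 * L))) \<partial>\<pi>)"
    proof (rule nn_integral_mono_AE)
      show "AE \<theta> in \<pi>. ennreal (exp (\<theta> * (exp (1 + b) - 1))) \<le> ennreal (exp (H * (3 * L)))"
        using supp
      proof eventually_elim
        case (elim \<theta>)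
        have "\<theta> * (exp (1 + b) - 1) \<le> H * (3 * L)"
          using elim H eb by (intro mult_mono) auto
        then show ?case by (simp add: ennreal_leI)
      qed
    qed
    also have "\<dots> = ennreal (exp (H * (3 * L)))" by (simp add: emeasure_space_1)
    finally have mgf: "(\<integral>\<^sup>+\<theta>. ennreal (exp (\<theta> * (exp (1 + b) - 1))) \<partial>\<pi>) \<le> ennreal (exp (H * (3 * L)))" .
    have "(\<Sum>x. ennreal (p x * tail_square m x)) \<le> ennreal (2 / 1\<^sup>2 * exp (- b * real m)) *
        (\<integral>\<^sup>+\<theta>. ennreal (exp (\<theta> * (exp (1 + b) - 1))) \<partial>\<pi>)"
      unfolding tail_square_def by (rule suminf_tail_second_moment) (use b in auto)
    also have "\<dots> \<le> ennreal (2 / 1\<^sup>2 * exp (- b * real m)) * ennreal (exp (H * (3 * L)))"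
      by (intro mult_left_mono mgf) auto
    also have "\<dots> = ennreal (2 * exp (H * (3 * L) - b * real m))"
      by (simp add: ennreal_mult'[symmetric] mult_exp_exp)
    also have "\<dots> \<le> ennreal (2 / (real n)\<^sup>2)"
    proof (rule ennreal_leI)
      have "b * (10 * H * l) \<le> b * real m" using m b by (intro mult_left_mono) auto
      moreover have "b * (10 * H * l) = 5 * (H * L)" using lnL by (simp add: b_def l_def)
      moreover have "1 * L \<le> H * L" using H L by (intro mult_right_mono) auto
      ultimately have "H * (3 * L) - b * real m \<le> - (2 * L)" by linarith
      then have "exp (H * (3 * L) - b * real m) \<le> exp (- (2 * L))" by simp
      also have "\<dots> = 1 / (real n)\<^sup>2"
        unfolding L_def by (rule exp_minus_2_ln) (use n in simp)
      finally show "2 * exp (H * (3 * L) - b * real m) \<le> 2 / (real n)\<^sup>2" by simp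
    qed
    finally show ?thesis .
  qed
  have "regret_le \<pi> n ((16 * (real m + 1)\<^sup>2 * h + 8 * (real m + 1) * (1 + 0) + 10 * 0
      + 2400 * (real m)\<^sup>2 * (4 * H) + 4 * 2) / real n)"
  proof (rule regret_bound)
    show "h \<le> real m" using m H l Hl by linarith
    show "(\<Sum>x\<le>m. real n * p x / ((1 + real n * p x) * (2 + real n * p x))) \<le> 4 * H"
      using under by (simp add: u_def)
  qed (use n h H excess tail in auto)
  then show ?thesis
  proof (rule regret_le_mono)
    define q where "q = H * l"
    have q: "1 \<le> q" using Hl by (simp add: q_def)
    have q2: "1 \<le> q\<^sup>2" "q \<le> q\<^sup>2" using q self_le_power[OF q, of 2] by auto
    have m2: "(real m + 1)\<^sup>2 \<le> 144 * q\<^sup>2" "(real m)\<^sup>2 \<le> 144 * q\<^sup>2"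
      using power_mono[OF m(2), of 2] power_mono[of "real m" "12 * (H * l)" 2] m(2)
      by (auto simp: q_def power_mult_distrib)
    define W where "W = H * q\<^sup>2"
    have "q\<^sup>2 \<le> W" unfolding W_def using H by (simp add: mult_le_cancel_right1)
    then have W: "1 \<le> W" "q \<le> W" using q2 by (blast intro: order_trans)+
    have "16 * (real m + 1)\<^sup>2 * h \<le> 16 * (144 * q\<^sup>2) * H"
      using m2 H h by (intro mult_mono) auto
    then have "16 * (real m + 1)\<^sup>2 * h \<le> 2304 * W" by (simp add: W_def mult_ac)
    moreover have "2400 * (real m)\<^sup>2 * (4 * H) \<le> 2400 * (144 * q\<^sup>2) * (4 * H)"
      using m2 H by (intro mult_mono) auto
    then have "2400 * (real m)\<^sup>2 * (4 * H) \<le> 1382400 * W" by (simp add: W_def mult_ac)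
    moreover have "8 * (real m + 1) \<le> 96 * W"
      using m(2)[folded q_def] W by simp
    ultimately have "16 * (real m + 1)\<^sup>2 * h + 8 * (real m + 1)
        + 2400 * (real m)\<^sup>2 * (4 * H) + 4 * 2 \<le> 2304 * W + 96 * W + 1382400 * W + 8 * W"
      using W(1) by (intro add_mono) auto
    also have "\<dots> \<le> 10 ^ 7 * W" using W(1) by simp
    also have "W = H ^ 3 * l\<^sup>2" by (simp add: W_def q_def power2_eq_square power3_eq_cube)
    finally show "(16 * (real m + 1)\<^sup>2 * h + 8 * (real m + 1) * (1 + 0) + 10 * 0
        + 2400 * (real m)\<^sup>2 * (4 * H) + 4 * 2) / real n
      \<le> 10 ^ 7 * (max 1 h) ^ 3 / real n * (ln (real n) / ln (ln (real n)))\<^sup>2"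
      using n by (simp add: H_def[symmetric] L_def[symmetric] l_def[symmetric] divide_right_mono)
  qed
qed

text \<open>The half line is cut into cells of length \<open>s\<close>. On cell \<open>k\<close> the
  integrand is at most \<open>exp ((k + 1) / 2)\<close> against a tail of
  \<open>2 * exp (- k)\<close>, which leaves a geometric series of ratio
  \<open>exp (- 1/2)\<close>.\<close>

lemma subexponential_mgf:
  assumes s: "0 < s" and tail: "\<And>t. 0 < t \<Longrightarrow> measure \<pi> {t..} \<le> 2 * exp (- t / s)"
  shows "(\<integral>\<^sup>+\<theta>. ennreal (exp (\<theta> / (2 * s))) \<partial>\<pi>) \<le> ennreal 11"
proof -
  define r :: real where "r = exp (- (1/2))"
  let ?c = "\<lambda>k :: nat. exp ((real k + 1) / 2)"
  have "(\<integral>\<^sup>+\<theta>. ennreal (exp (\<theta> / (2 * s))) \<partial>\<pi>)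
      \<le> (\<integral>\<^sup>+\<theta>. (\<Sum>k. ennreal (?c k) * indicator {real k * s..} \<theta>) \<partial>\<pi>)"
  proof (rule nn_integral_mono_AE)
    show "AE \<theta> in \<pi>. ennreal (exp (\<theta> / (2 * s))) \<le> (\<Sum>k. ennreal (?c k) * indicator {real k * s..} \<theta>)"
      using prior_nonneg
    proof eventually_elim
      case (elim \<theta>)
      define k where "k = nat \<lfloor>\<theta> / s\<rfloor>"
      have "0 \<le> \<theta> / s" using elim s by simp
      then have k: "real k \<le> \<theta> / s" "\<theta> / s < real k + 1" unfolding k_def by linarith+
      have "exp (\<theta> / (2 * s)) \<le> ?c k" using k s by (simp add: field_simps)
      then have "ennreal (exp (\<theta> / (2 * s))) \<le> ennreal (?c k) * indicator {real k * s..} \<theta>"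
        using k s by (simp add: ennreal_leI field_simps)
      also have "\<dots> \<le> (\<Sum>k. ennreal (?c k) * indicator {real k * s..} \<theta>)"
        using sum_le_suminf[OF summableI, of "{k}" "\<lambda>k. ennreal (?c k) * indicator {real k * s..} \<theta>"]
        by (simp only: finite.intros sum.insert sum.empty empty_iff add_0_right simp_thms zero_le)
      finally show ?case .
    qed
  qed
  also have "\<dots> = (\<Sum>k. ennreal (?c k) * emeasure \<pi> {real k * s..})"
    by (subst nn_integral_suminf) (auto simp: sets_prior nn_integral_cmult)
  also have "\<dots> \<le> (\<Sum>k. ennreal (2 * exp (1/2) * r ^ k))"
  proof (intro suminf_le)
    fix k :: nat
    have "measure \<pi> {real k * s..} \<le> 2 * exp (- real k)"
    \<comment> \<open>The tail hypothesis covers only positive \<open>t\<close>; at 0 a probability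
      is trivially at most 2.\<close>
    proof (cases "k = 0")
      case True
      then show ?thesis using order_trans[OF prob_le_1[of "{0..}"], of 2] by simp
    qed (use tail[of "real k * s"] s in simp)
    then have "?c k * measure \<pi> {real k * s..} \<le> ?c k * (2 * exp (- real k))"
      by (intro mult_left_mono) auto
    also have "\<dots> = 2 * exp (1/2) * r ^ k"
      unfolding r_def exp_of_nat_mult[symmetric]
      by (simp add: mult_exp_exp mult.left_commute add_divide_distrib)
    finally show "ennreal (?c k) * emeasure \<pi> {real k * s..} \<le> ennreal (2 * exp (1/2) * r ^ k)"
      by (simp add: emeasure_eq_measure ennreal_mult'[symmetric] ennreal_leI)
  qed auto
  also have "\<dots> = ennreal (2 * exp (1/2) * (1 / (1 - r)))"
    by (intro suminf_ennreal_sums sums_mult geometric_sums) (auto simp: r_def)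
  also have "\<dots> \<le> ennreal 11"
  proof (rule ennreal_leI)
    have e: "3 / 2 \<le> exp (1/2 :: real)" using exp_ge_add_one_self[of "1/2 :: real"] by simp
    have e': "exp (1/2 :: real) \<le> 7 / 4" using exp_bound[of "1/2 :: real"] by (simp add: power2_eq_square)
    have "r \<le> 2 / 3" using e unfolding r_def exp_minus by (simp add: field_simps)
    then have "1 / (1 - r) \<le> 3" by (simp add: field_simps)
    then have "2 * exp (1/2) * (1 / (1 - r)) \<le> 2 * (7 / 4) * 3"
      using e' by (intro mult_mono) (auto simp: r_def)
    then show "2 * exp (1/2) * (1 / (1 - r)) \<le> 11" by simp
  qed
  finally show ?thesis .
qed

text \<open>Here \<open>T\<close> and \<open>m\<close> are both of order \<open>S * L\<close>, and
  every point up to \<open>m\<close> may count as an undercount, so \<open>A\<close> has that order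
  too; \<open>m^2 * T\<close> and \<open>m^2 * A\<close> give the cube.\<close>

lemma regret_bound_subexponential:
  assumes n: "3 \<le> n" and s: "0 < s"
    and tail: "\<And>t. 0 < t \<Longrightarrow> measure \<pi> {t..} \<le> 2 * exp (- t / s)"
  shows "regret_le \<pi> n (10 ^ 7 * (max 1 s) ^ 3 / real n * (ln (real n)) ^ 3)"
proof -
  define S where "S = max 1 s"
  define L where "L = ln (real n)"
  \<comment> \<open>Chosen so that \<open>T / (2 * S) = 2 * L\<close>: at the exponential rate
    \<open>1 / (2 * S)\<close> the excess beyond \<open>T\<close> is then of order
    \<open>1 / n^2\<close>.\<close>
  define T where "T = 4 * S * L"
  define m where "m = nat \<lceil>12 * S * L\<rceil>"
  have S: "1 \<le> S" "s \<le> S" by (auto simp: S_def)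
  have L: "1 < L" unfolding L_def by (rule ln_gt_1[OF n])
  have SL: "S \<le> S * L" "1 \<le> S * L"
    using S L mult_left_mono[of 1 L S] by linarith+
  have m: "12 * S * L \<le> real m" "real m + 1 \<le> 14 * (S * L)"
    using nat_ceiling_bounds[of "12 * S * L"] SL unfolding m_def by linarith+
  have exp_n: "exp (- (2 * L)) = 1 / (real n)\<^sup>2"
    unfolding L_def by (rule exp_minus_2_ln) (use n in simp)
  have mgf: "(\<integral>\<^sup>+\<theta>. ennreal (exp (\<theta> / (2 * S))) \<partial>\<pi>) \<le> ennreal 11"
  proof (rule subexponential_mgf)
    fix t :: real assume t: "0 < t"
    have "t / S \<le> t / s" using t s S by (intro divide_left_mono) auto
    then have "2 * exp (- t / s) \<le> 2 * exp (- t / S)" by simp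
    with tail[OF t] show "measure \<pi> {t..} \<le> 2 * exp (- t / S)" by linarith
  qed (use S in simp)
  have under: "(\<Sum>x\<le>m. real n * p x / ((1 + real n * p x) * (2 + real n * p x))) \<le> 14 * (S * L)"
  proof -
    have "(\<Sum>x\<le>m. real n * p x / ((1 + real n * p x) * (2 + real n * p x))) \<le> real (card {..m}) * 1"
      by (intro sum_bounded_above undercount_le_1) (simp add: pmix_nonneg)
    then show ?thesis using m by simp
  qed
  have excess: "(\<integral>\<^sup>+\<theta>. ennreal ((max 0 (\<theta> - T))\<^sup>2) \<partial>\<pi>) \<le> ennreal (88 * S\<^sup>2 / (real n)\<^sup>2)"
  proof -
    have pt: "(max 0 (\<theta> - T))\<^sup>2 \<le> 8 * S\<^sup>2 * exp (- (2 * L)) * exp (\<theta> / (2 * S))" for \<theta>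
    proof (cases "\<theta> \<le> T")
      case False
      define y where "y = (\<theta> - T) / (2 * S)"
      have y: "0 \<le> y" "\<theta> - T = 2 * S * y" using False S by (auto simp: y_def)
      have "y\<^sup>2 / 2 \<le> exp y" using exp_lower_Taylor_quadratic[OF y(1)] y(1) by linarith
      then have "8 * S\<^sup>2 * (y\<^sup>2 / 2) \<le> 8 * S\<^sup>2 * exp y" by (intro mult_left_mono) auto
      moreover have "(max 0 (\<theta> - T))\<^sup>2 = 8 * S\<^sup>2 * (y\<^sup>2 / 2)"
        using y S by (simp add: power_mult_distrib)
      moreover have "y = - (2 * L) + \<theta> / (2 * S)"
        using S by (simp add: y_def T_def field_simps)
      ultimately show ?thesis by (simp only: exp_add mult.assoc)
    qed simp
    have "(\<integral>\<^sup>+\<theta>. ennreal ((max 0 (\<theta> - T))\<^sup>2) \<partial>\<pi>)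
        \<le> (\<integral>\<^sup>+\<theta>. ennreal (8 * S\<^sup>2 * exp (- (2 * L))) * ennreal (exp (\<theta> / (2 * S))) \<partial>\<pi>)"
      using pt by (intro nn_integral_mono) (simp add: ennreal_mult'[symmetric] ennreal_leI)
    also have "\<dots> = ennreal (8 * S\<^sup>2 * exp (- (2 * L))) * (\<integral>\<^sup>+\<theta>. ennreal (exp (\<theta> / (2 * S))) \<partial>\<pi>)"
      by (rule nn_integral_cmult) measurable
    also have "\<dots> \<le> ennreal (8 * S\<^sup>2 * exp (- (2 * L))) * ennreal 11"
      by (intro mult_left_mono mgf zero_le)
    also have "\<dots> = ennreal (88 * S\<^sup>2 / (real n)\<^sup>2)"
      unfolding exp_n by (subst ennreal_mult'[symmetric]) auto
    finally show ?thesis .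
  qed
  have tail: "(\<Sum>x. ennreal (p x * tail_square m x)) \<le> ennreal (792 * S\<^sup>2 / (real n)\<^sup>2)"
  proof -
    \<comment> \<open>Both Chernoff rates equal \<open>b\<close>. Then
      \<open>exp (b + b) - 1\<close> is at most \<open>3 * b = 1 / (2 * S)\<close>, where the
      exponential moment is known, and \<open>b * (12 * S * L) = 2 * L\<close> explains the choice
      of \<open>m\<close>.\<close>
    define b where "b = 1 / (6 * S)"
    have b: "0 < b" using S by (simp add: b_def)
    have "exp (b + b) \<le> 1 + (b + b) + (b + b)\<^sup>2"
      using S by (intro exp_bound) (auto simp: b_def field_simps)
    also have "(b + b)\<^sup>2 \<le> (b + b) * (1 / 2)"
      unfolding power2_eq_square using S by (intro mult_left_mono) (auto simp: b_def field_simps)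
    also have "1 + (b + b) + (b + b) * (1 / 2) = 1 + 1 / (2 * S)" by (simp add: b_def field_simps)
    finally have eb: "exp (b + b) - 1 \<le> 1 / (2 * S)" by simp
    have "(\<integral>\<^sup>+\<theta>. ennreal (exp (\<theta> * (exp (b + b) - 1))) \<partial>\<pi>) \<le> (\<integral>\<^sup>+\<theta>. ennreal (exp (\<theta> / (2 * S))) \<partial>\<pi>)"
    proof (rule nn_integral_mono_AE)
      show "AE \<theta> in \<pi>. ennreal (exp (\<theta> * (exp (b + b) - 1))) \<le> ennreal (exp (\<theta> / (2 * S)))"
        using prior_nonneg
      proof eventually_elim
        case (elim \<theta>)
        from mult_left_mono[OF eb elim] show ?case by (simp add: ennreal_leI)
      qed
    qed
    then have mgf': "(\<integral>\<^sup>+\<theta>. ennreal (exp (\<theta> * (exp (b + b) - 1))) \<partial>\<pi>) \<le> ennreal 11"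
      using mgf by (rule order_trans)
    have "(\<Sum>x. ennreal (p x * tail_square m x)) \<le> ennreal (2 / b\<^sup>2 * exp (- b * real m)) *
        (\<integral>\<^sup>+\<theta>. ennreal (exp (\<theta> * (exp (b + b) - 1))) \<partial>\<pi>)"
      unfolding tail_square_def by (rule suminf_tail_second_moment) (use b in auto)
    also have "\<dots> \<le> ennreal (2 / b\<^sup>2 * exp (- b * real m)) * ennreal 11"
      by (intro mult_left_mono mgf') auto
    also have "\<dots> = ennreal (792 * S\<^sup>2 * exp (- b * real m))"
      by (subst ennreal_mult'[symmetric]) (auto simp: b_def power_mult_distrib field_simps)
    also have "\<dots> \<le> ennreal (792 * S\<^sup>2 * exp (- (2 * L)))"
    proof (intro ennreal_leI mult_left_mono)
      have "b * (12 * S * L) \<le> b * real m" using m b by (intro mult_left_mono) auto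
      moreover have "b * (12 * S * L) = 2 * L" using S by (simp add: b_def)
      ultimately show "exp (- b * real m) \<le> exp (- (2 * L))" by simp
    qed auto
    finally show ?thesis unfolding exp_n by simp
  qed
  have "regret_le \<pi> n ((16 * (real m + 1)\<^sup>2 * T + 8 * (real m + 1) * (1 + 88 * S\<^sup>2) + 10 * (88 * S\<^sup>2)
      + 2400 * (real m)\<^sup>2 * (14 * (S * L)) + 4 * (792 * S\<^sup>2)) / real n)"
  proof (rule regret_bound[OF _ _ _ _ _ _ under excess tail])
    show "0 \<le> T" using S L by (simp add: T_def)
    show "T \<le> real m" using m SL unfolding T_def by linarith
    show "0 \<le> 14 * (S * L)" using S L by simp
  qed (use n in auto)
  then show ?thesis
  proof (rule regret_le_mono)
    define q where "q = S * L"
    have q: "1 \<le> q" "S \<le> q" using SL by (auto simp: q_def)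
    have S2: "S\<^sup>2 \<le> q\<^sup>2" "q\<^sup>2 \<le> q ^ 3" "q \<le> q ^ 3"
      using power_mono[OF q(2), of 2] power_increasing[OF _ q(1), of 2 3] self_le_power[OF q(1), of 3] S
      by auto
    have m2: "(real m + 1)\<^sup>2 \<le> 196 * q\<^sup>2" "(real m)\<^sup>2 \<le> 196 * q\<^sup>2"
      using power_mono[OF m(2), of 2] power_mono[of "real m" "14 * (S * L)" 2] m(2)
      by (auto simp: q_def power_mult_distrib)
    have T: "T = 4 * q" by (simp add: T_def q_def)
    have "16 * (real m + 1)\<^sup>2 * T \<le> 16 * (196 * q\<^sup>2) * (4 * q)"
      unfolding T using m2 q by (intro mult_mono) auto
    also have "\<dots> = 12544 * q ^ 3" by (simp add: power2_eq_square power3_eq_cube)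
    finally have 1: "16 * (real m + 1)\<^sup>2 * T \<le> 12544 * q ^ 3" .
    have "8 * (real m + 1) * (1 + 88 * S\<^sup>2) \<le> 8 * (14 * q) * (89 * q\<^sup>2)"
    proof (intro mult_mono)
      have "1 \<le> q\<^sup>2" using q by simp
      then show "1 + 88 * S\<^sup>2 \<le> 89 * q\<^sup>2" using S2 by linarith
    qed (use m(2)[folded q_def] q in auto)
    also have "\<dots> = 9968 * q ^ 3" by (simp add: power2_eq_square power3_eq_cube)
    finally have 2: "8 * (real m + 1) * (1 + 88 * S\<^sup>2) \<le> 9968 * q ^ 3" .
    have "2400 * (real m)\<^sup>2 * (14 * q) \<le> 2400 * (196 * q\<^sup>2) * (14 * q)"
      using m2 q by (intro mult_mono) auto
    also have "\<dots> = 6585600 * q ^ 3" by (simp add: power2_eq_square power3_eq_cube)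
    finally have 3: "2400 * (real m)\<^sup>2 * (14 * q) \<le> 6585600 * q ^ 3" .
    have "16 * (real m + 1)\<^sup>2 * T + 8 * (real m + 1) * (1 + 88 * S\<^sup>2) + 10 * (88 * S\<^sup>2)
        + 2400 * (real m)\<^sup>2 * (14 * q) + 4 * (792 * S\<^sup>2)
      \<le> 12544 * q ^ 3 + 9968 * q ^ 3 + 10 * (88 * q ^ 3) + 6585600 * q ^ 3 + 4 * (792 * q ^ 3)"
      using S2 by (intro add_mono 1 2 3) auto
    also have "\<dots> \<le> 10 ^ 7 * q ^ 3" using q by simp
    finally have "16 * (real m + 1)\<^sup>2 * T + 8 * (real m + 1) * (1 + 88 * S\<^sup>2) + 10 * (88 * S\<^sup>2)
        + 2400 * (real m)\<^sup>2 * (14 * q) + 4 * (792 * S\<^sup>2) \<le> 10 ^ 7 * q ^ 3" .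
    then show "(16 * (real m + 1)\<^sup>2 * T + 8 * (real m + 1) * (1 + 88 * S\<^sup>2) + 10 * (88 * S\<^sup>2)
        + 2400 * (real m)\<^sup>2 * (14 * (S * L)) + 4 * (792 * S\<^sup>2)) / real n
      \<le> 10 ^ 7 * (max 1 s) ^ 3 / real n * (ln (real n)) ^ 3"
      using n by (simp add: S_def[symmetric] L_def[symmetric] q_def power_mult_distrib divide_right_mono)
  qed
qed

end

lemma priorI:
  assumes "prob_space \<pi>" "sets \<pi> = sets borel" "measure \<pi> A = 1" "A \<in> sets borel" "A \<subseteq> {0..}"
  shows "prior \<pi>" "AE \<theta> in \<pi>. \<theta> \<in> A"
proof -
  interpret prob_space \<pi> by fact
  show A: "AE \<theta> in \<pi>. \<theta> \<in> A"
    using assms(2-4) by (simp add: AE_in_set_eq_1)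
  then have "AE \<theta> in \<pi>. 0 \<le> \<theta>" by eventually_elim (use assms(5) in auto)
  then show "prior \<pi>" using assms(2) by unfold_locales auto
qed

theorem theorem1:
  shows "\<exists>C>0. \<forall>n::nat. n \<ge> 3 \<longrightarrow>
     (\<forall>h>0. \<forall>\<pi>. supported_on_0h h \<pi> \<longrightarrow>
        regret_le \<pi> n (C * (max 1 h) ^ 3 / real n * (ln (real n) / ln (ln (real n)))\<^sup>2)) \<and>
     (\<forall>s>0. \<forall>\<pi>. SubE s \<pi> \<longrightarrow>
        regret_le \<pi> n (C * (max 1 s) ^ 3 / real n * (ln (real n)) ^ 3))"
proof (intro exI[of _ "10 ^ 7"] conjI allI impI)
  fix n :: nat and h :: real and \<pi> assume n: "3 \<le> n" and h: "0 < h" and "supported_on_0h h \<pi>"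
  then have *: "prob_space \<pi>" "sets \<pi> = sets borel" "measure \<pi> {0..h} = 1"
    by (auto simp: supported_on_0h_def)
  interpret prior \<pi> by (rule priorI(1)[OF *]) auto
  have "AE \<theta> in \<pi>. \<theta> \<in> {0..h}" by (rule priorI(2)[OF *]) auto
  then have "AE \<theta> in \<pi>. \<theta> \<le> h" by eventually_elim simp
  then show "regret_le \<pi> n (10 ^ 7 * (max 1 h) ^ 3 / real n * (ln (real n) / ln (ln (real n)))\<^sup>2)"
    by (rule regret_bound_bounded_support[OF n h])
next
  fix n :: nat and s :: real and \<pi> assume n: "3 \<le> n" and s: "0 < s" and "SubE s \<pi>"
  then have *: "prob_space \<pi>" "sets \<pi> = sets borel" "measure \<pi> {0..} = 1"
    and tail: "\<And>t. 0 < t \<Longrightarrow> measure \<pi> {t..} \<le> 2 * exp (- t / s)"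
    by (auto simp: SubE_def)
  interpret prior \<pi> by (rule priorI(1)[OF *]) auto
  show "regret_le \<pi> n (10 ^ 7 * (max 1 s) ^ 3 / real n * (ln (real n)) ^ 3)"
    by (rule regret_bound_subexponential[OF n s tail])
qed simp

end
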